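(* Let $q$ be a complex number with $|q|<1$, let $P(q)=1-24\sum_{j\ge1}\frac{jq^j}{1-q^j}$, and let $$z=\prod_{j=1}^\infty\frac{(1-q^j)^4(1-q^{3j})^4}{(1-q^{2j})^2(1-q^{6j})^2},\qquad y=q\prod_{j=1}^\infty\frac{(1-q^{2j})^6(1-q^{6j})^6}{(1-q^j)^6(1-q^{3j})^6}.$$ Let $u(n)=\sum_{j=0}^n\binom nj^2\binom{2j}j\binom{2n-2j}{n-j}$ (the Domb numbers), and let $\{t(n)\}$ be defined by $t(0)=1$ and $$(n+1)^3t(n+1)=-2n(n+1)(2n+1)t(n)+16n(5n^2+1)t(n-1)-96n(n-1)(2n-1)t(n-2)\quad(n\ge0).$$ Put $Z=(1+4y)z$ and $x=\frac{y}{1+4y}$. Then in a neighborhood of $q=0$, $$Z=\tfrac12\bigl(3P(q^6)-P(q^2)\bigr)=\sum_{n=0}^\infty t(n)x^n=\sum_{n=0}^\infty(-1)^nu(n)\frac{x^n}{(1-4x)^{n+1}}=\sum_{n=0}^\infty\binom{3n}n\binom{2n}n^2x^{2n}(1-4x)^n.$$ *)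

theory Defs
  imports "HOL-Analysis.Analysis"
begin

text \<open>
  Sums and products over \<open>j \<ge> 1\<close> are indexed from \<open>0\<close> and written with \<^term>\<open>Suc j\<close>.
  They all converge for \<^term>\<open>norm q < 1\<close>, the only range where these functions are meaningful.
\<close>

definition eis_P :: "complex \<Rightarrow> complex" where
  "eis_P q = 1 - 24 * (\<Sum>j. of_nat (Suc j) * q ^ Suc j / (1 - q ^ Suc j))"

definition mod_z :: "complex \<Rightarrow> complex" where
  "mod_z q = (\<Prod>j. ((1 - q ^ Suc j) ^ 4 * (1 - q ^ (3 * Suc j)) ^ 4) /
                    ((1 - q ^ (2 * Suc j)) ^ 2 * (1 - q ^ (6 * Suc j)) ^ 2))"

definition mod_y :: "complex \<Rightarrow> complex" where
  "mod_y q = q * (\<Prod>j. ((1 - q ^ (2 * Suc j)) ^ 6 * (1 - q ^ (6 * Suc j)) ^ 6) /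
                        ((1 - q ^ Suc j) ^ 6 * (1 - q ^ (3 * Suc j)) ^ 6))"

definition mod_Z :: "complex \<Rightarrow> complex" where
  "mod_Z q = (1 + 4 * mod_y q) * mod_z q"

definition mod_x :: "complex \<Rightarrow> complex" where
  "mod_x q = mod_y q / (1 + 4 * mod_y q)"

definition domb :: "nat \<Rightarrow> nat" where
  "domb n = (\<Sum>j=0..n. (n choose j)\<^sup>2 * ((2 * j) choose j) * ((2 * n - 2 * j) choose (n - j)))"

end

theory Submission
  imports Defs "HOL-Complex_Analysis.Complex_Analysis"
begin

text \<open>
  Write \<open>\<theta> = q d/dq\<close>, and let \<open>P\<^sub>i\<close> and \<open>Q\<^sub>i\<close> be the Eisenstein series of weights 2 and 4 at \<open>q\<^sup>i\<close>.
  Liouville's elementary method evaluates certain sums over \<open>a x + b y = n\<close> and thereby some quadratic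
  forms in \<open>P\<^sub>1, P\<^sub>2, P\<^sub>3, P\<^sub>6\<close> in terms of \<open>\<theta> P\<^sub>i\<close> and \<open>Q\<^sub>i\<close>. Eliminating the \<open>Q\<^sub>i\<close> shows that
  \<open>z\<close> and \<open>y z\<close> have the same logarithmic derivatives as certain linear combinations of the \<open>P\<^sub>i\<close>,
  with which they therefore agree; this identifies \<open>Z\<close>. The remaining relations, with \<open>W = \<theta> y / y\<close> and
  \<open>M = \<theta> z / z\<close>, read \<open>W\<^sup>2 = z\<^sup>2 (1 + 4 y) (1 + 16 y)\<close> and \<open>2 \<theta> M = M\<^sup>2 - 8 y (1 + 8 y) z\<^sup>2\<close>. They amount
  to a third order linear differential equation for \<open>z\<close> in \<open>y\<close>, and after a change of variables for
  \<open>Z\<close> in \<open>x\<close> and in \<open>x\<^sup>2 (1 - 4 x)\<close>. The Domb numbers, \<open>t\<close> and the hypergeometric coefficients satisfy the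
  corresponding recurrences.
\<close>

unbundle no vec_syntax

section \<open>Liouville's method\<close>

lemma sum_involution_split:
  fixes h :: "'a \<Rightarrow> 'b :: semiring_1" and u :: "'a \<Rightarrow> 'c :: linorder"
  assumes "finite S"
    and \<sigma>: "\<And>s. s \<in> S \<Longrightarrow> \<sigma> s \<in> S" "\<And>s. s \<in> S \<Longrightarrow> \<sigma> (\<sigma> s) = s"
    and h: "\<And>s. s \<in> S \<Longrightarrow> h (\<sigma> s) = h s"
  shows "sum h S = 2 * sum h {s \<in> S. u s < u (\<sigma> s)} + sum h {s \<in> S. u s = u (\<sigma> s)}"
proof -
  let ?L = "{s \<in> S. u s < u (\<sigma> s)}" and ?E = "{s \<in> S. u s = u (\<sigma> s)}"
    and ?G = "{s \<in> S. u (\<sigma> s) < u s}"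
  have "S = (?L \<union> ?G) \<union> ?E" by (auto simp: not_less_iff_gr_or_eq)
  then have "sum h S = sum h ((?L \<union> ?G) \<union> ?E)" by (rule arg_cong)
  also have "\<dots> = (sum h ?L + sum h ?G) + sum h ?E"
    using \<open>finite S\<close> by (subst sum.union_disjoint; (subst sum.union_disjoint)?) auto
  also have "sum h ?G = sum h ?L"
    by (rule sum.reindex_bij_witness[where i = \<sigma> and j = \<sigma>]) (use \<sigma> h in auto)
  finally show ?thesis by (simp add: mult_2)
qed

definition quads :: "nat \<Rightarrow> (nat \<times> nat \<times> nat \<times> nat) set" where
  "quads n = {(a, b, x, y). 0 < a \<and> 0 < b \<and> 0 < x \<and> 0 < y \<and> a * x + b * y = n}"

lemma quads_0 [simp]: "quads 0 = {}"
  by (auto simp: quads_def)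

lemma finite_quads [simp]: "finite (quads n)"
proof (rule finite_subset)
  show "quads n \<subseteq> {..n} \<times> {..n} \<times> {..n} \<times> {..n}"
  proof (clarsimp simp: quads_def)
    fix a b x y :: nat assume "0 < a" "0 < b" "0 < x" "0 < y"
    then have "a \<le> a * x" "x \<le> a * x" "b \<le> b * y" "y \<le> b * y" by auto
    then show "a \<le> a * x + b * y \<and> b \<le> a * x + b * y \<and> x \<le> a * x + b * y \<and> y \<le> a * x + b * y"
      by linarith
  qed
qed auto

lemma sum_quads_symmetric:
  fixes h :: "nat \<Rightarrow> nat \<Rightarrow> nat \<Rightarrow> nat \<Rightarrow> 'a :: semiring_1"
  assumes "\<And>a b x y. h a b x y = h b a y x"
  shows "(\<Sum>(a, b, x, y)\<in>quads n. h a b x y) =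
      2 * (\<Sum>(a, b, x, y)\<in>{(a, b, x, y) \<in> quads n. b < a}. h a b x y) +
      (\<Sum>(a, b, x, y)\<in>{(a, b, x, y) \<in> quads n. a = b}. h a b x y)" (is ?split_a_b)
    and "(\<Sum>(a, b, x, y)\<in>quads n. h a b x y) =
      2 * (\<Sum>(a, b, x, y)\<in>{(a, b, x, y) \<in> quads n. x < y}. h a b x y) +
      (\<Sum>(a, b, x, y)\<in>{(a, b, x, y) \<in> quads n. x = y}. h a b x y)" (is ?split_x_y)
proof -
  let ?\<sigma> = "\<lambda>(a, b, x, y). (b, a, y, x) :: nat \<times> nat \<times> nat \<times> nat"
  have split: "(\<Sum>(a, b, x, y)\<in>quads n. h a b x y) =
      2 * (\<Sum>(a, b, x, y)\<in>{s \<in> quads n. u s < u (?\<sigma> s)}. h a b x y) +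
      (\<Sum>(a, b, x, y)\<in>{s \<in> quads n. u s = u (?\<sigma> s)}. h a b x y)"
    for u :: "nat \<times> nat \<times> nat \<times> nat \<Rightarrow> nat"
    by (rule sum_involution_split[OF finite_quads]) (auto simp: quads_def add.commute assms)
  let ?b = "\<lambda>(a, b, x, y). b" and ?x = "\<lambda>(a, b, x, y). x"
  have "{s \<in> quads n. ?b s < ?b (?\<sigma> s)} = {(a, b, x, y) \<in> quads n. b < a}"
    "{s \<in> quads n. ?b s = ?b (?\<sigma> s)} = {(a, b, x, y) \<in> quads n. a = b}"
    "{s \<in> quads n. ?x s < ?x (?\<sigma> s)} = {(a, b, x, y) \<in> quads n. x < y}"
    "{s \<in> quads n. ?x s = ?x (?\<sigma> s)} = {(a, b, x, y) \<in> quads n. x = y}"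
    by auto
  with split[of ?b] split[of ?x] show ?split_a_b and ?split_x_y by (simp_all only:)
qed

lemma sum_quads_shift:
  fixes g :: "nat \<Rightarrow> nat \<Rightarrow> nat \<Rightarrow> nat \<Rightarrow> 'a :: comm_monoid_add"
  shows "(\<Sum>(a, b, x, y)\<in>{(a, b, x, y) \<in> quads n. b < a}. g a b x y) =
    (\<Sum>(a, b, x, y)\<in>{(a, b, x, y) \<in> quads n. x < y}. g (a + b) b x (y - x))"
proof -
  have "(a - b) * x + b * (x + y) = a * x + b * y" if "b < a" for a b x y :: nat
    using less_imp_add_positive[OF that] by (auto simp: algebra_simps)
  moreover have "(a + b) * x + b * (y - x) = a * x + b * y" if "x < y" for a b x y :: nat
    using less_imp_add_positive[OF that] by (auto simp: algebra_simps)
  ultimately show ?thesis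
    by (intro sum.reindex_bij_witness[where i = "\<lambda>(a, b, x, y). (a + b, b, x, y - x)"
          and j = "\<lambda>(a, b, x, y). (a - b, b, x, x + y)"]) (auto simp: quads_def)
qed

text \<open>The sum of \<open>t\<close> telescopes because \<open>(a, b, x, y) \<mapsto> (a + b, b, x, y - x)\<close> preserves
  \<open>a x + b y\<close> and exchanges the conditions \<open>x < y\<close> and \<open>b < a\<close>.\<close>

lemma sum_quads_telescope:
  fixes g t :: "nat \<Rightarrow> nat \<Rightarrow> nat \<Rightarrow> nat \<Rightarrow> 'a :: comm_ring_1"
  assumes g_sym: "\<And>a b x y. g a b x y = g b a y x"
    and t_sym: "\<And>a b x y. t a b x y = t b a y x"
    and t_eq: "\<And>a b x y. x \<le> y \<Longrightarrow> t a b x y = g a b x y - g (a + b) b x (y - x)"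
  shows "(\<Sum>(a, b, x, y)\<in>quads n. t a b x y) =
    (\<Sum>(a, b, x, y)\<in>{(a, b, x, y) \<in> quads n. a = b}. g a b x y) -
    (\<Sum>(a, b, x, y)\<in>{(a, b, x, y) \<in> quads n. x = y}. g (a + b) b x 0)"
proof -
  let ?S = "\<lambda>h r. \<Sum>(a, b, x, y)\<in>{(a, b, x, y) \<in> quads n. r a b x y}. h a b x y :: 'a"
  let ?L = "\<lambda>a b x y. x < y" and ?E = "\<lambda>a b x y. x = y"
    and ?g' = "\<lambda>a b x y. g (a + b) b x (y - x)"
  have tL: "?S t ?L = ?S g ?L - ?S ?g' ?L"
    unfolding sum_subtractf[symmetric] by (rule sum.cong) (auto simp: t_eq)
  have tE: "?S t ?E = ?S g ?E - ?S (\<lambda>a b x y. g (a + b) b x 0) ?E"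
    unfolding sum_subtractf[symmetric] by (rule sum.cong) (auto simp: t_eq)
  have "(\<Sum>(a, b, x, y)\<in>quads n. t a b x y) = 2 * ?S t ?L + ?S t ?E"
    by (rule sum_quads_symmetric(2)[OF t_sym])
  also have "\<dots> = (2 * ?S g ?L + ?S g ?E) - 2 * ?S ?g' ?L - ?S (\<lambda>a b x y. g (a + b) b x 0) ?E"
    unfolding tL tE by (simp only: right_diff_distrib add_diff_eq diff_add_eq diff_right_commute)
  also have "2 * ?S g ?L + ?S g ?E = 2 * ?S ?g' ?L + ?S g (\<lambda>a b x y. a = b)"
    unfolding sum_quads_shift[symmetric]
    by (rule trans[OF sum_quads_symmetric(2)[OF g_sym, symmetric] sum_quads_symmetric(1)[OF g_sym]])
  finally show ?thesis by simp
qed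

lemma sum_quads_a_eq_b:
  fixes h :: "nat \<Rightarrow> nat \<Rightarrow> nat \<Rightarrow> 'a :: comm_monoid_add"
  assumes "n > 0"
  shows "(\<Sum>(a, b, x, y)\<in>{(a, b, x, y) \<in> quads n. a = b}. h a x y) =
    (\<Sum>d | d dvd n. \<Sum>x\<in>{0<..<n div d}. h d x (n div d - x))"
proof -
  have "(\<Sum>(a, b, x, y)\<in>{(a, b, x, y) \<in> quads n. a = b}. h a x y) =
      (\<Sum>(d, x)\<in>Sigma {d. d dvd n} (\<lambda>d. {0<..<n div d}). h d x (n div d - x))"
  proof (rule sum.reindex_bij_witness[where i = "\<lambda>(d, x). (d, d, x, n div d - x)"
          and j = "\<lambda>(a, b, x, y). (a, x)"])
  qed (use assms in \<open>auto simp: quads_def simp flip: distrib_left dest: dvd_pos_nat\<close>)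
  then show ?thesis using assms by (simp add: sum.Sigma)
qed

lemma sum_quads_x_eq_y:
  fixes h :: "nat \<Rightarrow> nat \<Rightarrow> nat \<Rightarrow> 'a :: comm_monoid_add"
  assumes "n > 0"
  shows "(\<Sum>(a, b, x, y)\<in>{(a, b, x, y) \<in> quads n. x = y}. h a b x) =
    (\<Sum>m | m dvd n. \<Sum>a\<in>{0<..<m}. h a (m - a) (n div m))"
proof -
  have "(\<Sum>(a, b, x, y)\<in>{(a, b, x, y) \<in> quads n. x = y}. h a b x) =
      (\<Sum>(a, b, x, y)\<in>{(a, b, x, y) \<in> quads n. a = b}. h x y a)"
    by (rule sum.reindex_bij_witness[where i = "\<lambda>(a, b, x, y). (x, y, a, b)"
          and j = "\<lambda>(a, b, x, y). (x, y, a, b)"]) (auto simp: quads_def mult.commute)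
  also have "\<dots> = (\<Sum>d | d dvd n. \<Sum>x\<in>{0<..<n div d}. h x (n div d - x) d)"
    by (rule sum_quads_a_eq_b[OF assms])
  also have "\<dots> = (\<Sum>m | m dvd n. \<Sum>a\<in>{0<..<m}. h a (m - a) (n div m))"
    by (rule sum.reindex_bij_witness[where i = "\<lambda>d. n div d" and j = "\<lambda>d. n div d"])
       (use assms in auto)
  finally show ?thesis .
qed

lemma sum_mult_diff:
  "(\<Sum>a\<in>{0<..<m}. of_nat a * of_nat (m - a)) = ((of_nat m ^ 3 - of_nat m) / 6 :: 'a :: field_char_0)"
proof -
  have "(\<Sum>a<k. of_nat a * (c - of_nat a)) =
      (of_nat k * (of_nat k - 1) * (3 * c - 2 * of_nat k + 1) / 6 :: 'a)" for k c
    by (induction k) (simp_all add: field_simps)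
  from this[of "of_nat m" m]
  have "(\<Sum>a<m. of_nat a * of_nat (m - a)) = ((of_nat m ^ 3 - of_nat m) / 6 :: 'a)"
    by (simp add: of_nat_diff power3_eq_cube algebra_simps cong: sum.cong_simp)
  moreover have "(\<Sum>a\<in>{0<..<m}. of_nat a * of_nat (m - a)) = (\<Sum>a<m. of_nat a * of_nat (m - a) :: 'a)"
    by (rule sum.mono_neutral_left) auto
  ultimately show ?thesis by simp
qed

lemma sum_quads_a_eq_b_square:
  fixes I :: "nat \<Rightarrow> 'a :: comm_ring_1"
  assumes "n > 0"
  shows "(\<Sum>(a, b, x, y)\<in>{(a, b, x, y) \<in> quads n. a = b}. of_nat a ^ 2 * I (x + y)) =
    (\<Sum>m | m dvd n. (of_nat n * of_nat m - of_nat m ^ 2) * I (n div m))"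
proof -
  have "(\<Sum>(a, b, x, y)\<in>{(a, b, x, y) \<in> quads n. a = b}. of_nat a ^ 2 * I (x + y)) =
      (\<Sum>m | m dvd n. \<Sum>x\<in>{0<..<n div m}. of_nat m ^ 2 * I (n div m))"
    by (subst sum_quads_a_eq_b[OF assms]) (intro sum.cong, auto)
  also have "\<dots> = (\<Sum>m | m dvd n. (of_nat n * of_nat m - of_nat m ^ 2) * I (n div m))"
    by (rule sum.cong) (use assms in \<open>auto elim!: dvdE simp: of_nat_diff algebra_simps power2_eq_square\<close>)
  finally show ?thesis .
qed

lemma sum_quads_x_eq_y_square:
  fixes I :: "nat \<Rightarrow> 'a :: field_char_0"
  assumes "n > 0"
  shows "(\<Sum>(a, b, x, y)\<in>{(a, b, x, y) \<in> quads n. x = y}.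
      of_nat (a + b) ^ 2 * I x - c * (of_nat a * of_nat b)) =
    (\<Sum>m | m dvd n. (of_nat m ^ 3 - of_nat m ^ 2) * I (n div m) - c * (of_nat m ^ 3 - of_nat m) / 6)"
proof -
  have "(\<Sum>(a, b, x, y)\<in>{(a, b, x, y) \<in> quads n. x = y}.
        of_nat (a + b) ^ 2 * I x - c * (of_nat a * of_nat b)) =
      (\<Sum>m | m dvd n. \<Sum>a\<in>{0<..<m}. of_nat m ^ 2 * I (n div m) - c * (of_nat a * of_nat (m - a)))"
    by (subst sum_quads_x_eq_y[OF assms]) (intro sum.cong, auto)
  also have "\<dots> = (\<Sum>m | m dvd n.
      (of_nat m ^ 3 - of_nat m ^ 2) * I (n div m) - c * (of_nat m ^ 3 - of_nat m) / 6)"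
  proof (intro sum.cong refl)
    fix m assume "m \<in> {m. m dvd n}"
    then have "m > 0" using assms by (auto intro: Nat.gr0I)
    then show "(\<Sum>a\<in>{0<..<m}. of_nat m ^ 2 * I (n div m) - c * (of_nat a * of_nat (m - a))) =
        (of_nat m ^ 3 - of_nat m ^ 2) * I (n div m) - c * (of_nat m ^ 3 - of_nat m) / 6"
      by (simp only: sum_subtractf sum_mult_diff sum_distrib_left[symmetric])
         (simp add: of_nat_diff power2_eq_square power3_eq_cube algebra_simps)
  qed
  finally show ?thesis .
qed

text \<open>With truncated subtraction, \<open>x - y + (y - x)\<close> is \<open>\<bar>x - y\<bar>\<close>.\<close>

theorem Liouville_identity:
  fixes I :: "nat \<Rightarrow> 'a :: field_char_0"
  assumes "n > 0"
  shows "(\<Sum>(a, b, x, y)\<in>quads n. of_nat a * of_nat b *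
           (I (x + y) + I (x - y + (y - x)) - 2 * I x - 2 * I y)) =
    (\<Sum>m | m dvd n.
      (of_nat n * of_nat m - of_nat m ^ 3) * I (n div m) + I 0 * (of_nat m ^ 3 - of_nat m) / 6)"
    (is "?lhs = ?rhs")
proof -
  let ?g = "\<lambda>a b x y. I x * of_nat a ^ 2 + I y * of_nat b ^ 2 +
      (I (x + y) - I x - I y) * of_nat a * of_nat b"
  have "?lhs = (\<Sum>(a, b, x, y)\<in>{(a, b, x, y) \<in> quads n. a = b}. ?g a b x y) -
      (\<Sum>(a, b, x, y)\<in>{(a, b, x, y) \<in> quads n. x = y}. ?g (a + b) b x 0)"
    by (rule sum_quads_telescope) (simp_all add: algebra_simps power2_eq_square)
  also have "(\<Sum>(a, b, x, y)\<in>{(a, b, x, y) \<in> quads n. a = b}. ?g a b x y) =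
      (\<Sum>(a, b, x, y)\<in>{(a, b, x, y) \<in> quads n. a = b}. of_nat a ^ 2 * I (x + y))"
    by (rule sum.cong) (auto simp: algebra_simps power2_eq_square)
  also have "(\<Sum>(a, b, x, y)\<in>{(a, b, x, y) \<in> quads n. x = y}. ?g (a + b) b x 0) =
      (\<Sum>(a, b, x, y)\<in>{(a, b, x, y) \<in> quads n. x = y}.
        of_nat (a + b) ^ 2 * I x - I 0 * (of_nat a * of_nat b))"
    by (rule sum.cong) (auto simp: algebra_simps power2_eq_square)
  finally show ?thesis
    unfolding sum_quads_a_eq_b_square[OF assms] sum_quads_x_eq_y_square[OF assms]
    by (simp add: algebra_simps flip: sum_subtractf)
qed

section \<open>Quadratic relations between Eisenstein series\<close>

definition lambert_fps :: "nat \<Rightarrow> (nat \<Rightarrow> 'a :: comm_semiring_1) \<Rightarrow> 'a fps" where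
  "lambert_fps e f = Abs_fps (\<lambda>n. if n = 0 then 0 else \<Sum>m | m dvd n. of_nat m ^ e * f (n div m))"

lemma lambert_fps_nth:
  "lambert_fps e f $ n = (if n = 0 then 0 else \<Sum>m | m dvd n. of_nat m ^ e * f (n div m))"
  by (simp add: lambert_fps_def)

lemma lambert_fps_nth_0 [simp]: "lambert_fps e f $ 0 = 0"
  by (simp add: lambert_fps_nth)

lemma lambert_fps_mult_nth:
  "(lambert_fps d f * lambert_fps e g) $ n =
     (\<Sum>(a, b, x, y)\<in>quads n. of_nat a ^ d * of_nat b ^ e * (f x * g y))"
proof -
  have pos: "0 < b \<and> 0 < (n - a) div b" if "b dvd n - a" "a < n" for a b
    using that dvd_pos_nat[of "n - a" b] by (auto simp: div_greater_zero_iff intro: dvd_imp_le)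
  have "(lambert_fps d f * lambert_fps e g) $ n =
      (\<Sum>i\<in>{0..n}. lambert_fps d f $ i * lambert_fps e g $ (n - i))"
    by (simp add: fps_mult_nth)
  also have "\<dots> = (\<Sum>i\<in>{0<..<n}. lambert_fps d f $ i * lambert_fps e g $ (n - i))"
    by (rule sum.mono_neutral_right) (auto simp: lambert_fps_nth)
  also have "\<dots> = (\<Sum>i\<in>{0<..<n}. \<Sum>(a, b)\<in>{a. a dvd i} \<times> {b. b dvd n - i}.
      of_nat a ^ d * f (i div a) * (of_nat b ^ e * g ((n - i) div b)))"
    by (intro sum.cong refl) (auto simp: lambert_fps_nth sum_product sum.cartesian_product)
  also have "\<dots> = (\<Sum>(i, a, b)\<in>Sigma {0<..<n} (\<lambda>i. {a. a dvd i} \<times> {b. b dvd n - i}).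
      of_nat a ^ d * f (i div a) * (of_nat b ^ e * g ((n - i) div b)))"
    by (subst sum.Sigma) (auto simp: case_prod_unfold)
  also have "\<dots> = (\<Sum>(a, b, x, y)\<in>quads n. of_nat a ^ d * of_nat b ^ e * (f x * g y))"
  proof (rule sum.reindex_bij_witness[where j = "\<lambda>(i, a, b). (a, b, i div a, (n - i) div b)"
          and i = "\<lambda>(a, b, x, y). (a * x, a, b)"])
  qed (use pos in \<open>auto simp: quads_def mult_ac dest: dvd_pos_nat\<close>)
  finally show ?thesis .
qed

lemma fps_XD_lambert_fps: "fps_XD (lambert_fps e f) = lambert_fps (Suc e) (\<lambda>k. of_nat k * f k)"
proof (rule fps_ext)
  fix n
  have "of_nat n * (of_nat m ^ e * f (n div m)) = of_nat m ^ Suc e * (of_nat (n div m) * f (n div m))"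
    if "m dvd n" for m
    using that by (auto elim!: dvdE simp: mult_ac)
  then show "fps_XD (lambert_fps e f) $ n = lambert_fps (Suc e) (\<lambda>k. of_nat k * f k) $ n"
    by (simp add: lambert_fps_nth sum_distrib_left del: power_Suc)
qed

definition sigma_fps :: "nat \<Rightarrow> nat \<Rightarrow> 'a :: comm_semiring_1 fps" where
  "sigma_fps e i = lambert_fps e (\<lambda>k. of_bool (i dvd k))"

lemma sigma_fps_nth: "sigma_fps e i $ n = (if n = 0 then 0 else \<Sum>m | m * i dvd n. of_nat m ^ e)"
proof (cases "n = 0")
  case False
  have "m dvd n \<and> i dvd n div m \<longleftrightarrow> m * i dvd n" for m
    using False by (cases "m = 0") (auto simp: dvd_div_iff_mult mult_ac dest: dvd_mult_left)
  then have "{m. m dvd n} \<inter> {m. i dvd n div m} = {m. m * i dvd n}" by auto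
  with False show ?thesis by (simp add: sigma_fps_def lambert_fps_nth)
qed (simp add: sigma_fps_def)

lemma sigma_fps_nth_0 [simp]: "sigma_fps e i $ 0 = 0"
  by (simp add: sigma_fps_nth)

lemma sigma_fps_compose_X_power:
  assumes "k > 0"
  shows "sigma_fps e i oo fps_X ^ k = (sigma_fps e (i * k) :: 'a :: comm_ring_1 fps)"
proof (rule fps_ext)
  fix n
  have "m * i dvd n div k \<longleftrightarrow> m * (i * k) dvd n" if "k dvd n" for m
    using that assms by (simp add: dvd_div_iff_mult mult.assoc)
  moreover have "\<not> m * (i * k) dvd n" if "\<not> k dvd n" for m
    using that by (metis dvd_mult_right mult.assoc)
  ultimately show "(sigma_fps e i oo fps_X ^ k) $ n = sigma_fps e (i * k) $ n"
    using assms by (auto simp: fps_nth_compose_X_power sigma_fps_nth dvd_div_eq_0_iff)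
qed

lemma Liouville_sigma_fps:
  fixes cs :: "(int \<times> nat \<times> nat) list"
  assumes "\<And>x y. (\<Sum>(c, j, k)\<leftarrow>cs. c * (of_bool (j dvd x) * of_bool (k dvd y))) =
    of_bool (i dvd x + y) + of_bool (i dvd x - y + (y - x)) - 2 * of_bool (i dvd x) - 2 * of_bool (i dvd y)"
  shows "6 * (\<Sum>(c, j, k)\<leftarrow>cs. of_int c * (sigma_fps 1 j * sigma_fps 1 k)) =
    6 * fps_XD (sigma_fps 1 i) - 6 * sigma_fps 3 i + sigma_fps 3 1 - (sigma_fps 1 1 :: 'a :: field_char_0 fps)"
    (is "6 * ?lhs = ?rhs")
proof (rule fps_ext)
  fix n
  let ?I = "\<lambda>x. of_bool (i dvd x) :: 'a"
  have "?lhs $ n = (\<Sum>(a, b, x, y)\<in>quads n. of_nat a * of_nat b *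
      of_int (\<Sum>(c, j, k)\<leftarrow>cs. c * (of_bool (j dvd x) * of_bool (k dvd y))))"
    by (induction cs) (auto simp: sigma_fps_def lambert_fps_mult_nth sum_distrib_left sum.distrib[symmetric]
        case_prod_unfold algebra_simps fps_of_int[symmetric] intro!: sum.cong)
  then have lhs: "?lhs $ n = (\<Sum>(a, b, x, y)\<in>quads n. of_nat a * of_nat b *
      (?I (x + y) + ?I (x - y + (y - x)) - 2 * ?I x - 2 * ?I y))"
    by (simp add: assms)
  show "(6 * ?lhs) $ n = ?rhs $ n"
  proof (cases "n = 0")
    case False
    have "(6 * ?lhs) $ n = 6 * (\<Sum>m | m dvd n.
        (of_nat n * of_nat m - of_nat m ^ 3) * ?I (n div m) + ?I 0 * (of_nat m ^ 3 - of_nat m) / 6)"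
      using Liouville_identity[of n ?I] False by (simp only: fps_mult_numeral_left lhs)
    also have "\<dots> = (\<Sum>m | m dvd n. 6 * (of_nat n * (of_nat m * ?I (n div m))) -
        6 * (of_nat m ^ 3 * ?I (n div m)) + of_nat m ^ 3 - of_nat m)"
      unfolding sum_distrib_left by (rule sum.cong) (simp_all add: field_simps)
    also have "\<dots> = ?rhs $ n"
      using False by (simp add: sigma_fps_def lambert_fps_nth sum.distrib sum_subtractf sum_distrib_left
          del: sum_mult_of_bool_eq sum_of_bool_mult_eq)
    finally show ?thesis .
  qed (use lhs in simp)
qed

definition eis_P_fps :: "nat \<Rightarrow> 'a :: comm_ring_1 fps" where
  "eis_P_fps i = 1 - 24 * sigma_fps 1 i"

definition eis_Q_fps :: "nat \<Rightarrow> 'a :: comm_ring_1 fps" where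
  "eis_Q_fps i = 1 + 240 * sigma_fps 3 i"

lemma fps_XD_eis_P_fps: "fps_XD (eis_P_fps i) = - 24 * fps_XD (sigma_fps 1 i)"
  by (rule fps_ext) (simp add: eis_P_fps_def)

lemma sum_list_sigma_fps:
  fixes cs :: "(int \<times> nat) list"
  assumes "\<And>x. (\<Sum>(c, j)\<leftarrow>cs. c * of_bool (j dvd x)) = d"
  shows "(\<Sum>(c, j)\<leftarrow>cs. of_int c * sigma_fps e j) = (of_int d * sigma_fps e 1 :: 'a :: comm_ring_1 fps)"
proof -
  have "(\<Sum>(c, j)\<leftarrow>cs. of_int c * sigma_fps e j) =
      (lambert_fps e (\<lambda>x. of_int (\<Sum>(c, j)\<leftarrow>cs. c * of_bool (j dvd x))) :: 'a fps)"
    by (induction cs) (auto simp: fps_eq_iff sigma_fps_def lambert_fps_nth sum.distrib sum_distrib_left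
        algebra_simps fps_of_int[symmetric] simp del: sum_mult_of_bool_eq sum_of_bool_mult_eq)
  then show ?thesis
    by (simp add: assms fps_eq_iff sigma_fps_def lambert_fps_nth sum_distrib_left mult.commute
        fps_of_int[symmetric])
qed

theorem Liouville_eis_fps:
  fixes cs :: "(int \<times> nat \<times> nat) list"
  assumes "\<And>x y. (\<Sum>(c, j, k)\<leftarrow>cs. c * (of_bool (j dvd x) * of_bool (k dvd y))) =
    of_bool (i dvd x + y) + of_bool (i dvd x - y + (y - x)) - 2 * of_bool (i dvd x) - 2 * of_bool (i dvd y)"
  shows "5 * (\<Sum>(c, j, k)\<leftarrow>cs. of_int c * (eis_P_fps j * eis_P_fps k)) =
    2 * eis_Q_fps 1 - 12 * eis_Q_fps i - (120 * fps_XD (eis_P_fps i) :: 'a :: field_char_0 fps)"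
proof -
  let ?s = "sigma_fps 1 :: nat \<Rightarrow> 'a fps"
  have "(\<Sum>(c, j)\<leftarrow>map (\<lambda>(c, j, k). (c, j)) cs. c * of_bool (j dvd x)) = - 2"
    and "(\<Sum>(c, k)\<leftarrow>map (\<lambda>(c, j, k). (c, k)) cs. c * of_bool (k dvd x)) = - 2" for x
    using assms[of x 0] assms[of 0 x] by (simp_all add: comp_def case_prod_unfold)
  from this[THEN sum_list_sigma_fps[where ?'a = 'a and e = 1]]
  have linear: "(\<Sum>(c, j, k)\<leftarrow>cs. of_int c * ?s j) = - 2 * ?s 1"
    "(\<Sum>(c, j, k)\<leftarrow>cs. of_int c * ?s k) = - 2 * ?s 1"
    by (simp_all add: comp_def case_prod_unfold)
  have const: "(\<Sum>(c, j, k)\<leftarrow>cs. c) = - 2"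
    using assms[of 0 0] by simp
  have "(\<Sum>(c, j, k)\<leftarrow>cs. of_int c * (eis_P_fps j * eis_P_fps k)) =
      of_int (\<Sum>(c, j, k)\<leftarrow>cs. c) - 24 * (\<Sum>(c, j, k)\<leftarrow>cs. of_int c * ?s j) -
      24 * (\<Sum>(c, j, k)\<leftarrow>cs. of_int c * ?s k) + 576 * (\<Sum>(c, j, k)\<leftarrow>cs. of_int c * (?s j * ?s k))"
    by (induction cs) (auto simp: eis_P_fps_def algebra_simps)
  then show ?thesis
    using Liouville_sigma_fps[OF assms, where ?'a = 'a]
    unfolding const linear fps_XD_eis_P_fps of_int_minus of_int_numeral
    unfolding eis_P_fps_def eis_Q_fps_def by algebra
qed

lemma fps_XD_compose:
  fixes f v r :: "'a :: idom fps"
  assumes "v $ 0 = 0" "fps_XD v = v * r"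
  shows "fps_XD (f oo v) = (fps_XD f oo v) * r"
  using assms by (simp add: fps_XD_def fps_compose_deriv fps_compose_mult_distrib mult_ac)

lemma fps_XD_compose_X_power:
  fixes f :: "'a :: idom fps"
  assumes "k > 0"
  shows "fps_XD (f oo fps_X ^ k) = of_nat k * (fps_XD f oo fps_X ^ k)"
proof -
  have "fps_XD (fps_X ^ k) = fps_X ^ k * (of_nat k :: 'a fps)"
    by (rule fps_ext) (auto simp: mult.commute[of _ "of_nat k"] simp flip: fps_of_nat)
  from fps_XD_compose[OF _ this] assms show ?thesis by (simp add: mult.commute)
qed

lemma eis_fps_compose_X_power:
  assumes "k > 0"
  shows "eis_P_fps i oo fps_X ^ k = (eis_P_fps (i * k) :: 'a :: idom fps)"
    and "eis_Q_fps i oo fps_X ^ k = (eis_Q_fps (i * k) :: 'a :: idom fps)"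
  using assms by (simp_all add: eis_P_fps_def eis_Q_fps_def fps_compose_sub_distrib fps_compose_add_distrib
      fps_compose_mult_distrib sigma_fps_compose_X_power)

lemmas eis_fps_dilate = eis_fps_compose_X_power fps_compose_add_distrib fps_compose_sub_distrib
  fps_compose_mult_distrib power2_eq_square

theorem Ramanujan_eis_P_fps:
  assumes "i > 0"
  shows "12 * fps_XD (eis_P_fps i) = of_nat i * ((eis_P_fps i)\<^sup>2 - eis_Q_fps i :: 'a :: field_char_0 fps)"
proof -
  have "5 * (- 2 * (eis_P_fps 1)\<^sup>2) = - 10 * eis_Q_fps 1 - (120 * fps_XD (eis_P_fps 1) :: 'a fps)"
    using Liouville_eis_fps[of "[(- 2, 1, 1)]" 1, where ?'a = 'a] by (simp add: power2_eq_square)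
  then have "12 * fps_XD (eis_P_fps 1) = (eis_P_fps 1)\<^sup>2 - (eis_Q_fps 1 :: 'a fps)" by algebra
  from arg_cong[OF this, of "\<lambda>f. f oo fps_X ^ i"] show ?thesis
    using assms fps_XD_compose_X_power[OF assms, of "eis_P_fps 1 :: 'a fps"]
    by (simp add: eis_fps_dilate)
qed

theorem eis_fps_level_2:
  assumes "i > 0"
  shows "5 * (eis_P_fps i - 2 * eis_P_fps (2 * i))\<^sup>2 =
    (eis_Q_fps i + 4 * eis_Q_fps (2 * i) :: 'a :: field_char_0 fps)"
proof -
  have "(\<Sum>(c, j, k)\<leftarrow>[(2, 1, 1), (- 4, 1, 2), (- 4, 2, 1), (4, 2, 2)].
        c * (of_bool (j dvd x) * of_bool (k dvd y))) =
      of_bool (2 dvd x + y) + of_bool (2 dvd x - y + (y - x))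
        - 2 * of_bool (2 dvd x) - (2 * of_bool (2 dvd y) :: int)" for x y :: nat
    by auto
  from Liouville_eis_fps[OF this, where ?'a = 'a]
  have "5 * (eis_P_fps 1 - 2 * eis_P_fps 2)\<^sup>2 = (eis_Q_fps 1 + 4 * eis_Q_fps 2 :: 'a fps)"
    using Ramanujan_eis_P_fps[of 2, where ?'a = 'a] by simp algebra
  from arg_cong[OF this, of "\<lambda>f. f oo fps_X ^ i"] assms show ?thesis
    by (simp add: eis_fps_dilate)
qed

lemma of_bool_3_dvd_add_diff:
  "of_bool (3 dvd x + y) + of_bool (3 dvd x - y + (y - x)) =
    (1 - of_bool (3 dvd x) - of_bool (3 dvd y) + 3 * (of_bool (3 dvd x) * of_bool (3 dvd y)) :: int)"
  for x y :: nat
  by (simp add: of_bool_def) presburger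

lemma of_bool_6_dvd_add_diff:
  "of_bool (6 dvd x + y) + of_bool (6 dvd x - y + (y - x)) = of_bool (2 dvd x \<longleftrightarrow> 2 dvd y) *
    (1 - of_bool (3 dvd x) - of_bool (3 dvd y) + 3 * (of_bool (3 dvd x) * of_bool (3 dvd y)) :: int)"
  for x y :: nat
proof -
  have "6 dvd k \<longleftrightarrow> 2 dvd k \<and> 3 dvd k" for k :: nat by presburger
  moreover have "2 dvd x + y \<longleftrightarrow> (2 dvd x \<longleftrightarrow> 2 dvd y)"
    "2 dvd x - y + (y - x) \<longleftrightarrow> (2 dvd x \<longleftrightarrow> 2 dvd y)"
    by presburger+
  ultimately show ?thesis using of_bool_3_dvd_add_diff[of x y] by simp
qed

theorem eis_fps_level_3:
  assumes "i > 0"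
  shows "5 * (eis_P_fps i - 3 * eis_P_fps (3 * i))\<^sup>2 =
    2 * (eis_Q_fps i + 9 * eis_Q_fps (3 * i) :: 'a :: field_char_0 fps)"
proof -
  have "(\<Sum>(c, j, k)\<leftarrow>[(1, 1, 1), (- 3, 1, 3), (- 3, 3, 1), (3, 3, 3)].
        c * (of_bool (j dvd x) * of_bool (k dvd y))) =
      of_bool (3 dvd x + y) + of_bool (3 dvd x - y + (y - x))
        - 2 * of_bool (3 dvd x) - (2 * of_bool (3 dvd y) :: int)" for x y :: nat
    unfolding of_bool_3_dvd_add_diff by simp
  from Liouville_eis_fps[OF this, where ?'a = 'a]
  have "5 * (eis_P_fps 1 - 3 * eis_P_fps 3)\<^sup>2 = 2 * (eis_Q_fps 1 + 9 * eis_Q_fps 3 :: 'a fps)"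
    using Ramanujan_eis_P_fps[of 3, where ?'a = 'a] by simp algebra
  from arg_cong[OF this, of "\<lambda>f. f oo fps_X ^ i"] assms show ?thesis
    by (simp add: eis_fps_dilate)
qed

theorem eis_fps_level_6:
  assumes "i > 0"
  shows "5 * (eis_P_fps i - eis_P_fps (2 * i) - eis_P_fps (3 * i) - eis_P_fps (6 * i))\<^sup>2 =
    2 * (eis_Q_fps i - eis_Q_fps (2 * i) - eis_Q_fps (3 * i) + 11 * eis_Q_fps (6 * i)
      :: 'a :: field_char_0 fps)"
proof -
  have "6 dvd k \<longleftrightarrow> 2 dvd k \<and> 3 dvd k" for k :: nat by presburger
  then have "(\<Sum>(c, j, k)\<leftarrow>[(1, 1, 1), (- 1, 1, 2), (- 1, 2, 1), (- 1, 1, 3), (- 1, 3, 1), (- 1, 1, 6),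
        (- 1, 6, 1), (2, 2, 2), (1, 2, 3), (1, 3, 2), (- 2, 2, 6), (- 2, 6, 2), (3, 3, 3), (- 3, 3, 6),
        (- 3, 6, 3), (6, 6, 6)]. c * (of_bool (j dvd x) * of_bool (k dvd y))) =
      of_bool (6 dvd x + y) + of_bool (6 dvd x - y + (y - x))
        - 2 * of_bool (6 dvd x) - (2 * of_bool (6 dvd y) :: int)" for x y :: nat
    unfolding of_bool_6_dvd_add_diff by auto
  from Liouville_eis_fps[OF this, where ?'a = 'a]
  have "5 * (eis_P_fps 1 - eis_P_fps 2 - eis_P_fps 3 - eis_P_fps 6)\<^sup>2 =
      2 * (eis_Q_fps 1 - eis_Q_fps 2 - eis_Q_fps 3 + 11 * eis_Q_fps 6 :: 'a fps)"
    using Ramanujan_eis_P_fps[of 6, where ?'a = 'a] eis_fps_level_2[of 3, where ?'a = 'a]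
      eis_fps_level_3[of 2, where ?'a = 'a] by simp algebra
  from arg_cong[OF this, of "\<lambda>f. f oo fps_X ^ i"] assms show ?thesis
    by (simp add: eis_fps_dilate)
qed

section \<open>Third order differential equations\<close>

lemma fps_XD_diff [simp]: "fps_XD (f - g) = fps_XD f - (fps_XD g :: 'a :: comm_ring_1 fps)"
  and fps_XD_uminus [simp]: "fps_XD (- f) = - (fps_XD f :: 'a :: comm_ring_1 fps)"
  and fps_XD_numeral [simp]: "fps_XD (numeral k :: 'a :: comm_ring_1 fps) = 0"
  and fps_XD_1 [simp]: "fps_XD (1 :: 'a :: comm_ring_1 fps) = 0"
  and fps_XD_X: "fps_XD (fps_X :: 'a :: comm_ring_1 fps) = fps_X"
  and fps_XD_mult: "fps_XD (f * g) = fps_XD f * g + f * (fps_XD g :: 'a :: comm_ring_1 fps)"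
  by (simp_all add: fps_XD_def algebra_simps)

lemma fps_mult_nth_lowest:
  fixes f g :: "'a :: semiring_0 fps"
  assumes "\<And>k. k < n \<Longrightarrow> f $ k = 0"
  shows "(g * f) $ n = g $ 0 * f $ n"
proof -
  have "(g * f) $ n = (\<Sum>i\<in>{0..n}. g $ i * f $ (n - i))" by (simp add: fps_mult_nth)
  also have "\<dots> = (\<Sum>i\<in>{0}. g $ i * f $ (n - i))"
    using assms by (intro sum.mono_neutral_right) auto
  finally show ?thesis by simp
qed

lemma fps_XD_eq_mult_unique:
  fixes f g h :: "'a :: field_char_0 fps"
  assumes "fps_XD f = f * h" "fps_XD g = g * h" "h $ 0 = of_nat m" "f $ m = g $ m"
  shows "f = g"
proof (rule fps_ext)
  fix n show "f $ n = g $ n"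
  proof (induction n rule: less_induct)
    case (less n)
    have "fps_XD (f - g) = h * (f - g)" using assms(1,2) by (simp add: algebra_simps)
    then have "of_nat n * (f - g) $ n = (h * (f - g)) $ n" by (metis fps_XD_nth)
    also have "\<dots> = of_nat m * (f - g) $ n" using less assms(3) by (simp add: fps_mult_nth_lowest)
    finally show ?case using assms(4) by auto
  qed
qed

text \<open>If \<open>fps_XD v = v * r\<close>, this is the operator \<open>v d/dv\<close>.\<close>

definition scaled_XD :: "'a :: field fps \<Rightarrow> 'a fps \<Rightarrow> 'a fps" where
  "scaled_XD r f = inverse r * fps_XD f"

lemma scaled_XD_mult: "scaled_XD r (f * g) = scaled_XD r f * g + f * scaled_XD r g"
  by (simp add: scaled_XD_def fps_XD_mult algebra_simps)

lemma scaled_XD_add: "scaled_XD r (f + g) = scaled_XD r f + scaled_XD r g"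
  and scaled_XD_diff: "scaled_XD r (f - g) = scaled_XD r f - scaled_XD r g"
  and scaled_XD_numeral: "scaled_XD r (numeral k) = 0"
  by (simp_all add: scaled_XD_def algebra_simps)

lemma scaled_XD_power2: "scaled_XD r (f\<^sup>2) = 2 * f * scaled_XD r f"
  by (simp add: power2_eq_square scaled_XD_mult)

lemma fps_XD_eq_scaled_XD: "r $ 0 \<noteq> 0 \<Longrightarrow> fps_XD f = r * scaled_XD r f"
  using inverse_mult_eq_1'[of r] by (simp add: scaled_XD_def flip: mult.assoc)

lemma scaled_XD_compose:
  assumes "v $ 0 = 0" "fps_XD v = v * r" "r $ 0 \<noteq> 0"
  shows "scaled_XD r (f oo v) = fps_XD f oo v"
  using fps_XD_compose[OF assms(1,2), of f] inverse_mult_eq_1'[OF assms(3)]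
  by (simp add: scaled_XD_def mult_ac)

lemma funpow_scaled_XD_diff: "(scaled_XD r ^^ i) (f - g) = (scaled_XD r ^^ i) f - (scaled_XD r ^^ i) g"
  by (induction i) (simp_all add: scaled_XD_diff)

lemma funpow_scaled_XD_compose:
  assumes "v $ 0 = 0" "fps_XD v = v * r" "r $ 0 \<noteq> 0"
  shows "(scaled_XD r ^^ i) (f oo v) = (fps_XD ^^ i) f oo v"
  by (induction i) (simp_all add: scaled_XD_compose[OF assms])

lemma funpow_scaled_XD_nth_lowest:
  assumes "\<And>k. k < n \<Longrightarrow> f $ k = 0"
  shows "(scaled_XD r ^^ i) f $ n = (of_nat n / r $ 0) ^ i * f $ n"
proof -
  have "(\<forall>k<n. (scaled_XD r ^^ i) f $ k = 0) \<and> (scaled_XD r ^^ i) f $ n = (of_nat n / r $ 0) ^ i * f $ n"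
  proof (induction i)
    case (Suc i)
    let ?g = "(scaled_XD r ^^ i) f"
    have "scaled_XD r ?g $ k = inverse (r $ 0) * (of_nat k * ?g $ k)" if "k \<le> n" for k
      unfolding scaled_XD_def[of r ?g] using that Suc by (subst fps_mult_nth_lowest) auto
    with Suc show ?case by (auto simp: divide_inverse mult_ac)
  qed (use assms in auto)
  then show ?thesis by blast
qed

text \<open>The origin is a regular singular point, at which \<open>0\<close> is the only exponent.\<close>

lemma scaled_XD_equation_unique:
  fixes f :: "'a :: field_char_0 fps"
  assumes "(\<Sum>i\<le>k. a i * (scaled_XD r ^^ i) f) = 0" "\<And>i. i < k \<Longrightarrow> a i $ 0 = 0" "a k $ 0 \<noteq> 0"
    and "r $ 0 \<noteq> 0" "f $ 0 = 0"
  shows "f = 0"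
proof -
  have "f $ n = 0" for n
  proof (induction n rule: less_induct)
    case (less n)
    have "(\<forall>j<n. (scaled_XD r ^^ i) f $ j = 0)" for i
      using less funpow_scaled_XD_nth_lowest[where f = f and r = r and i = i] by force
    then have "(\<Sum>i\<le>k. a i * (scaled_XD r ^^ i) f) $ n = (\<Sum>i\<le>k. a i $ 0 * ((of_nat n / r $ 0) ^ i * f $ n))"
      using less by (simp add: fps_sum_nth fps_mult_nth_lowest funpow_scaled_XD_nth_lowest)
    also have "\<dots> = a k $ 0 * ((of_nat n / r $ 0) ^ k * f $ n)"
      using assms(2) by (simp add: lessThan_Suc_atMost[symmetric])
    finally show ?case
      using assms(1,3-5) by (cases "n = 0") auto
  qed
  then show ?thesis by (simp add: fps_ext)
qed

text \<open>With \<open>D = \<surd>\<rho> fps_XD\<close>, this is \<open>2 / \<surd>\<rho>\<close> times the symmetric square of \<open>D\<^sup>2 + \<kappa> / 2\<close>, the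
  operator that annihilates the products of any two solutions of \<open>D (D g) + (\<kappa> / 2) g = 0\<close>.\<close>

definition sym_square_op :: "'a :: comm_ring_1 fps \<Rightarrow> 'a fps \<Rightarrow> 'a fps \<Rightarrow> 'a fps" where
  "sym_square_op \<rho> \<kappa> f = 2 * \<rho> * fps_XD (fps_XD (fps_XD f)) + 3 * fps_XD \<rho> * fps_XD (fps_XD f) +
     (fps_XD (fps_XD \<rho>) + 4 * \<kappa>) * fps_XD f + 2 * fps_XD \<kappa> * f"

definition sym_square_coeff :: "'a :: comm_ring_1 fps \<Rightarrow> 'a fps \<Rightarrow> nat \<Rightarrow> nat \<Rightarrow> 'a" where
  "sym_square_coeff \<rho> \<kappa> n i = of_nat (2 * n - i) * (of_nat n * of_nat (n - i) * \<rho> $ i + 2 * \<kappa> $ i)"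

lemma sym_square_op_nth:
  "sym_square_op \<rho> \<kappa> f $ n = (\<Sum>i=0..n. sym_square_coeff \<rho> \<kappa> n i * f $ (n - i))"
proof -
  let ?c = "\<lambda>i. 2 * (\<rho> $ i * (of_nat (n - i) ^ 3 * f $ (n - i))) +
      3 * (of_nat i * \<rho> $ i * (of_nat (n - i) ^ 2 * f $ (n - i))) +
      (of_nat i ^ 2 * \<rho> $ i + 4 * \<kappa> $ i) * (of_nat (n - i) * f $ (n - i)) +
      2 * (of_nat i * \<kappa> $ i * f $ (n - i))"
  have "sym_square_op \<rho> \<kappa> f $ n = (\<Sum>i=0..n. ?c i)"
    unfolding sym_square_op_def distrib_right mult.assoc fps_add_nth fps_mult_numeral_left
    by (simp add: fps_mult_nth sum.distrib sum_distrib_left power2_eq_square power3_eq_cube mult.assoc)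
  also have "\<dots> = (\<Sum>i=0..n. sym_square_coeff \<rho> \<kappa> n i * f $ (n - i))"
  proof (intro sum.cong refl)
    fix i assume "i \<in> {0..n}"
    then obtain m where "n = i + m" by (auto simp: le_iff_add)
    then show "?c i = sym_square_coeff \<rho> \<kappa> n i * f $ (n - i)"
      by (simp add: sym_square_coeff_def algebra_simps power2_eq_square power3_eq_cube)
  qed
  finally show ?thesis .
qed

text \<open>
  \<open>r\<close> and \<open>M\<close> are the logarithmic derivatives of \<open>v\<close> and \<open>Y\<close>. For a modular function \<open>v\<close> and a modular
  form \<open>Y\<close> of weight 2, both \<open>(r / Y)\<^sup>2\<close> and \<open>(M\<^sup>2 - 2 fps_XD M) / Y\<^sup>2\<close> are modular functions.
\<close>

locale weight_2_system =
  fixes v r Y M \<rho> \<kappa> :: "'a :: field_char_0 fps"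
  assumes v_nth_0: "v $ 0 = 0" and XD_v: "fps_XD v = v * r" and r_nth_0: "r $ 0 \<noteq> 0"
    and XD_Y: "fps_XD Y = Y * M"
    and r_squared: "r\<^sup>2 = Y\<^sup>2 * (\<rho> oo v)"
    and XD_M: "2 * fps_XD M = M\<^sup>2 - 2 * Y\<^sup>2 * (\<kappa> oo v)"
begin

lemma Y_nth_0: "Y $ 0 \<noteq> 0" and \<rho>_nth_0: "\<rho> $ 0 \<noteq> 0"
  using arg_cong[OF r_squared, of "\<lambda>h. h $ 0"] r_nth_0 by (auto simp: power2_eq_square)

lemma \<kappa>_nth_0: "\<kappa> $ 0 = 0"
proof -
  have "M $ 0 = 0" using arg_cong[OF XD_Y, of "\<lambda>h. h $ 0"] Y_nth_0 by simp
  then show ?thesis using arg_cong[OF XD_M, of "\<lambda>h. h $ 0"] Y_nth_0 by (simp add: power2_eq_square)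
qed

abbreviation D :: "'a fps \<Rightarrow> 'a fps" where "D \<equiv> scaled_XD r"

lemmas XD_eq_D = fps_XD_eq_scaled_XD[OF r_nth_0]
lemmas D_compose = scaled_XD_compose[OF v_nth_0 XD_v r_nth_0]

lemma second_order_equation:
  "Y * ((fps_XD \<rho> oo v) * D Y + 2 * (\<rho> oo v) * D (D Y)) = (\<rho> oo v) * (D Y)\<^sup>2 - 2 * Y\<^sup>2 * (\<kappa> oo v)"
proof -
  have "Y \<noteq> 0" using Y_nth_0 by auto
  have Y_M: "Y * M = r * D Y" using XD_Y XD_eq_D by simp
  have "Y\<^sup>2 * M\<^sup>2 = Y\<^sup>2 * ((\<rho> oo v) * (D Y)\<^sup>2)" using Y_M r_squared by algebra
  then have M_squared: "M\<^sup>2 = (\<rho> oo v) * (D Y)\<^sup>2" using \<open>Y \<noteq> 0\<close> by simp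
  have D_r: "2 * r * D r = 2 * Y * D Y * (\<rho> oo v) + Y\<^sup>2 * (fps_XD \<rho> oo v)"
    using arg_cong[OF r_squared, of D] by (simp add: scaled_XD_power2 scaled_XD_mult D_compose)
  have D_Y_M: "D Y * M + Y * D M = D r * D Y + r * D (D Y)"
    using arg_cong[OF Y_M, of D] by (simp add: scaled_XD_mult)
  have "Y * (Y * ((fps_XD \<rho> oo v) * D Y + 2 * (\<rho> oo v) * D (D Y))) =
      Y * ((\<rho> oo v) * (D Y)\<^sup>2 - 2 * Y\<^sup>2 * (\<kappa> oo v))"
    using D_Y_M D_r M_squared XD_M[unfolded XD_eq_D] r_squared Y_M by algebra
  then show ?thesis using \<open>Y \<noteq> 0\<close> by simp
qed

lemma third_order_equation:
  "2 * (\<rho> oo v) * D (D (D Y)) + 3 * (fps_XD \<rho> oo v) * D (D Y) +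
    ((fps_XD (fps_XD \<rho>) oo v) + 4 * (\<kappa> oo v)) * D Y + 2 * (fps_XD \<kappa> oo v) * Y = 0" (is "?L = 0")
proof -
  have "Y * ?L = 0"
    using arg_cong[OF second_order_equation, of D]
    by (simp add: scaled_XD_power2 scaled_XD_mult scaled_XD_add scaled_XD_diff scaled_XD_numeral
        D_compose) algebra
  then show ?thesis using Y_nth_0 by auto
qed

theorem composition_eq:
  assumes f: "sym_square_op \<rho> \<kappa> f = 0" and "f $ 0 = Y $ 0"
  shows "Y = f oo v"
proof -
  define a where "a = (\<lambda>i. [2 * (fps_XD \<kappa> oo v), (fps_XD (fps_XD \<rho>) oo v) + 4 * (\<kappa> oo v),
    3 * (fps_XD \<rho> oo v), 2 * (\<rho> oo v)] ! i)"
  have "(\<Sum>i\<le>3. a i * (D ^^ i) (f oo v)) = sym_square_op \<rho> \<kappa> f oo v"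
    unfolding funpow_scaled_XD_compose[OF v_nth_0 XD_v r_nth_0]
    by (simp add: a_def eval_nat_numeral sym_square_op_def v_nth_0 fps_compose_add_distrib
        fps_compose_mult_distrib)
  moreover have "(\<Sum>i\<le>3. a i * (D ^^ i) Y) = 0"
    using third_order_equation by (simp add: a_def eval_nat_numeral add_ac)
  ultimately have "(\<Sum>i\<le>3. a i * (D ^^ i) (Y - (f oo v))) = 0"
    unfolding funpow_scaled_XD_diff right_diff_distrib sum_subtractf by (simp add: f)
  then have "Y - (f oo v) = 0"
  proof (rule scaled_XD_equation_unique)
    show "a i $ 0 = 0" if "i < 3" for i
      using that \<kappa>_nth_0 by (auto simp: a_def eval_nat_numeral less_Suc_eq)
    show "a 3 $ 0 \<noteq> 0" using \<rho>_nth_0 by (simp add: a_def)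
  qed (use r_nth_0 assms(2) in auto)
  then show ?thesis by simp
qed

end

lemma fps_conv_radius_pos_iff:
  fixes f :: "'a :: {banach, real_normed_div_algebra} fps"
  shows "fps_conv_radius f > 0 \<longleftrightarrow> (\<exists>B C. \<forall>n. norm (f $ n) \<le> B * C ^ n)"
proof
  assume "fps_conv_radius f > 0"
  then obtain r where r: "r > 0" "ereal r < fps_conv_radius f"
    using ereal_dense2[of 0] by auto
  then have "summable (\<lambda>n. norm (f $ n * of_real r ^ n))"
    unfolding fps_conv_radius_def by (intro abs_summable_in_conv_radius) simp
  from summable_imp_Bseq[OF this] obtain B where "\<And>n. norm (f $ n) * r ^ n \<le> B"
    using r by (auto simp: Bseq_def norm_mult norm_power)
  then have "norm (f $ n) \<le> B * (1 / r) ^ n" for n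
    using r by (simp add: power_divide field_simps)
  then show "\<exists>B C. \<forall>n. norm (f $ n) \<le> B * C ^ n" by blast
next
  assume "\<exists>B C. \<forall>n. norm (f $ n) \<le> B * C ^ n"
  then obtain B C where bound: "norm (f $ n) \<le> B * C ^ n" for n by blast
  then have "B \<ge> 0" using order_trans[OF norm_ge_zero bound[of 0]] by simp
  define r where "r = 1 / (2 * \<bar>C\<bar> + 1)"
  have "r > 0" by (simp add: r_def)
  have "summable (\<lambda>n. f $ n * of_real r ^ n)"
  proof (rule summable_comparison_test')
    show "summable (\<lambda>n. B * (1 / 2 :: real) ^ n)" by (intro summable_mult summable_geometric) simp
    fix n
    have "norm (f $ n) \<le> B * \<bar>C\<bar> ^ n"
      using bound[of n] \<open>B \<ge> 0\<close> by (elim order_trans) (simp add: mult_left_mono flip: power_abs)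
    then have "norm (f $ n * of_real r ^ n) \<le> B * (\<bar>C\<bar> * r) ^ n"
      using \<open>r > 0\<close> by (simp add: norm_mult norm_power mult_right_mono power_mult_distrib
          flip: mult.assoc)
    also have "\<dots> \<le> B * (1 / 2) ^ n"
      using \<open>B \<ge> 0\<close> by (intro mult_left_mono power_mono) (simp_all add: r_def field_simps)
    finally show "norm (f $ n * of_real r ^ n) \<le> B * (1 / 2) ^ n" .
  qed
  then have "ereal (norm (of_real r :: 'a)) \<le> fps_conv_radius f"
    unfolding fps_conv_radius_def by (rule conv_radius_geI)
  moreover have "0 < ereal (norm (of_real r :: 'a))" using \<open>r > 0\<close> by simp
  ultimately show "fps_conv_radius f > 0" by (rule less_le_trans[rotated])
qed

lemma geometric_convolution_bound:
  fixes a :: "nat \<Rightarrow> real"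
  assumes "D \<ge> 0" "a 0 \<ge> 0" and a: "\<And>n. n > 0 \<Longrightarrow> a n \<le> (\<Sum>i=1..n. D ^ i * a (n - i))"
  shows "a n \<le> (2 * D) ^ n * a 0"
proof (induction n rule: less_induct)
  case (less n)
  show ?case
  proof (cases "n = 0")
    case False
    have "a n \<le> (\<Sum>i=1..n. D ^ i * a (n - i))" using a False by simp
    also have "\<dots> \<le> (\<Sum>i=1..n. D ^ i * ((2 * D) ^ (n - i) * a 0))"
      using assms(1) by (intro sum_mono mult_left_mono less.IH) auto
    also have "\<dots> = (\<Sum>i=1..n. (1 / 2) ^ i) * ((2 * D) ^ n * a 0)"
      unfolding sum_distrib_right
    proof (rule sum.cong)
      fix i assume "i \<in> {1..n}"
      then have "(2 * D) ^ n = (2 * D) ^ i * (2 * D) ^ (n - i)"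
        using power_add[of "2 * D" i "n - i"] by simp
      then show "D ^ i * ((2 * D) ^ (n - i) * a 0) = (1 / 2) ^ i * ((2 * D) ^ n * a 0)"
        by (simp add: power_mult_distrib power_divide)
    qed simp
    also have "(\<Sum>i=1..n. (1 / 2) ^ i) = 1 - (1 / 2 :: real) ^ n"
      by (induction n) simp_all
    also have "(1 - (1 / 2) ^ n) * ((2 * D) ^ n * a 0) \<le> 1 * ((2 * D) ^ n * a 0)"
      using assms(1,2) by (intro mult_right_mono) simp_all
    finally show ?thesis by simp
  qed simp
qed

lemma norm_sym_square_coeff_le:
  fixes \<rho> \<kappa> :: "'a :: {banach, real_normed_field} fps"
  assumes "n > 0"
  shows "norm (sym_square_coeff \<rho> \<kappa> n i) \<le> 2 * real n ^ 3 * (norm (\<rho> $ i) + 2 * norm (\<kappa> $ i))"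
proof -
  have "norm (of_nat n * of_nat (n - i) * \<rho> $ i + 2 * \<kappa> $ i) \<le>
      real n * real (n - i) * norm (\<rho> $ i) + 2 * norm (\<kappa> $ i)"
    by (rule norm_triangle_le) (simp add: norm_mult)
  also have "\<dots> \<le> real n ^ 2 * norm (\<rho> $ i) + real n ^ 2 * (2 * norm (\<kappa> $ i))"
    using \<open>n > 0\<close> one_le_power[of "real n" 2]
    by (intro add_mono mult_right_mono) (auto simp: power2_eq_square mult_le_cancel_right1 mult_left_mono)
  also have "\<dots> = real n ^ 2 * (norm (\<rho> $ i) + 2 * norm (\<kappa> $ i))"
    by (simp only: distrib_left)
  finally have "norm (sym_square_coeff \<rho> \<kappa> n i) \<le>
      (2 * real n) * (real n ^ 2 * (norm (\<rho> $ i) + 2 * norm (\<kappa> $ i)))"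
    unfolding sym_square_coeff_def norm_mult by (intro mult_mono) (auto simp del: of_nat_diff)
  then show ?thesis by (simp add: power2_eq_square power3_eq_cube mult_ac)
qed

lemma sym_square_op_solution_bound:
  fixes f :: "'a :: {banach, real_normed_field} fps"
  assumes f: "sym_square_op \<rho> \<kappa> f = 0" and "\<rho> $ 0 \<noteq> 0" "\<kappa> $ 0 = 0" "n > 0"
    and growth: "\<And>i. i > 0 \<Longrightarrow> norm (\<rho> $ i) + 2 * norm (\<kappa> $ i) \<le> norm (\<rho> $ 0) * C ^ i"
  shows "norm (f $ n) \<le> (\<Sum>i=1..n. C ^ i * norm (f $ (n - i)))"
proof -
  let ?lead = "2 * real n ^ 3 * norm (\<rho> $ 0)"
  have "2 * of_nat n ^ 3 * \<rho> $ 0 * f $ n + (\<Sum>i=1..n. sym_square_coeff \<rho> \<kappa> n i * f $ (n - i)) =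
      sym_square_op \<rho> \<kappa> f $ n"
    using \<open>\<kappa> $ 0 = 0\<close>
    by (simp add: sym_square_op_nth sym_square_coeff_def sum.atLeast_Suc_atMost power3_eq_cube)
  then have "norm (2 * of_nat n ^ 3 * \<rho> $ 0 * f $ n) =
      norm (\<Sum>i=1..n. sym_square_coeff \<rho> \<kappa> n i * f $ (n - i))"
    unfolding f by (simp add: add_eq_0_iff2)
  also have "\<dots> \<le> (\<Sum>i=1..n. ?lead * (C ^ i * norm (f $ (n - i))))"
  proof (rule sum_norm_le)
    fix i assume "i \<in> {1..n}"
    then have "norm (sym_square_coeff \<rho> \<kappa> n i) \<le> 2 * real n ^ 3 * (norm (\<rho> $ 0) * C ^ i)"
      using norm_sym_square_coeff_le[OF \<open>n > 0\<close>, of \<rho> \<kappa> i] growth[of i]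
      by (elim order_trans) (simp add: mult_left_mono)
    then show "norm (sym_square_coeff \<rho> \<kappa> n i * f $ (n - i)) \<le> ?lead * (C ^ i * norm (f $ (n - i)))"
      unfolding norm_mult mult.assoc[symmetric] by (rule mult_right_mono) simp
  qed
  finally have "?lead * norm (f $ n) \<le> ?lead * (\<Sum>i=1..n. C ^ i * norm (f $ (n - i)))"
    by (simp add: norm_mult norm_power sum_distrib_left)
  then show ?thesis using \<open>n > 0\<close> \<open>\<rho> $ 0 \<noteq> 0\<close> by simp
qed

theorem sym_square_op_solution_conv_radius_pos:
  fixes f :: "'a :: {banach, real_normed_field} fps"
  assumes "sym_square_op \<rho> \<kappa> f = 0" "\<rho> $ 0 \<noteq> 0" "\<kappa> $ 0 = 0"
    and "fps_conv_radius \<rho> > 0" "fps_conv_radius \<kappa> > 0"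
  shows "fps_conv_radius f > 0"
proof -
  obtain A1 A2 B1 B2 where bounds: "\<And>i. norm (\<rho> $ i) \<le> A1 * B1 ^ i" "\<And>i. norm (\<kappa> $ i) \<le> A2 * B2 ^ i"
    using assms(4,5) unfolding fps_conv_radius_pos_iff by blast
  have "A1 \<ge> 0" "A2 \<ge> 0"
    using order_trans[OF norm_ge_zero bounds(1)[of 0]] order_trans[OF norm_ge_zero bounds(2)[of 0]]
    by simp_all
  define B where "B = max \<bar>B1\<bar> \<bar>B2\<bar>"
  define L where "L = max 1 ((A1 + 2 * A2) / norm (\<rho> $ 0))"
  have "B \<ge> 0" "L \<ge> 1" by (simp_all add: B_def L_def)
  have "norm (\<rho> $ i) + 2 * norm (\<kappa> $ i) \<le> norm (\<rho> $ 0) * (L * B) ^ i" if "i > 0" for i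
  proof -
    have "B1 ^ i \<le> B ^ i" "B2 ^ i \<le> B ^ i"
      by (rule order_trans[OF abs_ge_self], simp add: B_def power_abs power_mono)+
    then have "norm (\<rho> $ i) \<le> A1 * B ^ i" "norm (\<kappa> $ i) \<le> A2 * B ^ i"
      using bounds[of i] \<open>A1 \<ge> 0\<close> \<open>A2 \<ge> 0\<close> by (meson mult_left_mono order_trans)+
    then have "norm (\<rho> $ i) + 2 * norm (\<kappa> $ i) \<le> (A1 + 2 * A2) * B ^ i" by (simp add: algebra_simps)
    also have "\<dots> \<le> norm (\<rho> $ 0) * L * B ^ i"
    proof (rule mult_right_mono)
      have "(A1 + 2 * A2) / norm (\<rho> $ 0) \<le> L" by (simp add: L_def)
      then show "A1 + 2 * A2 \<le> norm (\<rho> $ 0) * L" using assms(2) by (simp add: field_simps)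
    qed (use \<open>B \<ge> 0\<close> in simp)
    also have "\<dots> \<le> norm (\<rho> $ 0) * L ^ i * B ^ i"
      using that \<open>L \<ge> 1\<close> \<open>B \<ge> 0\<close> by (intro mult_right_mono mult_left_mono) (simp_all add: self_le_power)
    finally show ?thesis by (simp add: power_mult_distrib mult.assoc)
  qed
  from sym_square_op_solution_bound[OF assms(1-3) _ this]
  have "norm (f $ n) \<le> (2 * (L * B)) ^ n * norm (f $ 0)" for n
    using \<open>B \<ge> 0\<close> \<open>L \<ge> 1\<close> by (intro geometric_convolution_bound) auto
  then show ?thesis unfolding fps_conv_radius_pos_iff by (metis mult.commute)
qed

lemma has_fps_expansion_unique_eventually:
  assumes "f has_fps_expansion F" "g has_fps_expansion F"
  shows "\<forall>\<^sub>F q in nhds 0. f q = g q"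
  using assms unfolding has_fps_expansion_def by (auto elim: eventually_elim2)

lemma eventually_sums_fps_compose:
  fixes v y :: "complex \<Rightarrow> complex"
  assumes v: "v has_fps_expansion V" "V $ 0 = 0" and F: "fps_conv_radius F > 0"
    and y: "y has_fps_expansion (F oo V)"
  shows "\<forall>\<^sub>F q in nhds 0. (\<lambda>n. F $ n * v q ^ n) sums y q"
proof -
  have "(eval_fps F \<circ> v) has_fps_expansion (F oo V)"
    using F v by (intro has_fps_expansion_compose eval_fps_has_fps_expansion)
  from has_fps_expansion_unique_eventually[OF this y]
  have "\<forall>\<^sub>F q in nhds 0. eval_fps F (v q) = y q" by simp
  moreover have "v 0 = 0" using v has_fps_expansion_imp_0_eq_fps_nth_0 by metis
  then have "(v \<longlongrightarrow> 0) (nhds 0)"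
    using has_fps_expansion_imp_continuous[OF v(1), of UNIV]
    by (simp add: continuous_within tendsto_nhds_iff)
  then have "\<forall>\<^sub>F q in nhds 0. v q \<in> eball 0 (fps_conv_radius F)"
    by (rule topological_tendstoD) (use F in \<open>auto simp: zero_ereal_def\<close>)
  ultimately show ?thesis
    by eventually_elim (use sums_eval_fps in \<open>fastforce simp: in_eball_iff\<close>)
qed

theorem weight_2_system_eventually_sums:
  fixes v y :: "complex \<Rightarrow> complex"
  assumes system: "weight_2_system V r Y M \<rho> \<kappa>" and f: "sym_square_op \<rho> \<kappa> f = 0" "f $ 0 = Y $ 0"
    and "fps_conv_radius \<rho> > 0" "fps_conv_radius \<kappa> > 0"
    and v: "v has_fps_expansion V" and y: "y has_fps_expansion Y"
  shows "\<forall>\<^sub>F q in nhds 0. (\<lambda>n. f $ n * v q ^ n) sums y q"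
proof (rule eventually_sums_fps_compose[OF v])
  interpret weight_2_system V r Y M \<rho> \<kappa> by (rule system)
  show "V $ 0 = 0" by (rule v_nth_0)
  show "fps_conv_radius f > 0"
    using f(1) \<rho>_nth_0 \<kappa>_nth_0 assms(4,5) by (rule sym_square_op_solution_conv_radius_pos)
  show "y has_fps_expansion (f oo V)" using y composition_eq[OF f] by simp
qed

section \<open>The three coefficient sequences\<close>

lemma sym_square_op_fps_of_poly_eq_0I:
  assumes "degree p \<le> d" "degree k \<le> d"
    and "\<And>n. (\<Sum>i\<le>min d n. sym_square_coeff (fps_of_poly p) (fps_of_poly k) n i * f $ (n - i)) = 0"
  shows "sym_square_op (fps_of_poly p) (fps_of_poly k) f = 0"
proof (rule fps_ext)
  fix n
  have "coeff p i = 0 \<and> coeff k i = 0" if "\<not> i \<le> d" for i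
    using that assms(1,2) by (simp add: coeff_eq_0)
  then have "sym_square_op (fps_of_poly p) (fps_of_poly k) f $ n =
      (\<Sum>i\<le>min d n. sym_square_coeff (fps_of_poly p) (fps_of_poly k) n i * f $ (n - i))"
    unfolding sym_square_op_nth sym_square_coeff_def fps_of_poly_nth
    by (intro sum.mono_neutral_right ballI) auto
  then show "sym_square_op (fps_of_poly p) (fps_of_poly k) f $ n = 0 $ n" using assms(3) by simp
qed

lemma sym_square_op_t:
  fixes t :: "nat \<Rightarrow> 'a :: field_char_0"
  assumes t_rec: "\<And>n. of_nat (n + 1) ^ 3 * t (n + 1) =
        - 2 * of_nat n * of_nat (n + 1) * of_nat (2 * n + 1) * t n
        + 16 * of_nat n * (5 * of_nat n ^ 2 + 1) * t (n - 1)
        - 96 * of_nat n * (of_nat n - 1) * (2 * of_nat n - 1) * t (n - 2)"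
  shows "sym_square_op (fps_of_poly [:1, 4, - 80, 192:]) (fps_of_poly [:0, 0, - 48, 192:]) (Abs_fps t) = 0"
proof (rule sym_square_op_fps_of_poly_eq_0I[where d = 3])
  fix n
  let ?c = "sym_square_coeff (fps_of_poly [:1, 4, - 80, 192:]) (fps_of_poly [:0, 0, - 48, 192:]) n"
  consider (zero) "n = 0" | (one) "n = 1" | (two) "n = 2" | (ge_3) m where "n = Suc (Suc (Suc m))"
    by (metis One_nat_def not0_implies_Suc numeral_2_eq_2)
  then show "(\<Sum>i\<le>min 3 n. ?c i * Abs_fps t $ (n - i)) = 0"
  proof cases
    case ge_3
    show ?thesis
      unfolding ge_3 using t_rec[of "Suc (Suc m)"]
      by (simp add: sym_square_coeff_def eval_nat_numeral) algebra
  next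
    case two
    then show ?thesis
      using t_rec[of 1] t_rec[of 0] by (simp add: sym_square_coeff_def eval_nat_numeral)
  next
    case one
    then show ?thesis using t_rec[of 0] by (simp add: sym_square_coeff_def)
  qed (simp add: sym_square_coeff_def)
qed simp_all

lemma binomial_central_fact: "of_nat ((2 * n) choose n) = (fact (2 * n) / fact n ^ 2 :: 'a :: field_char_0)"
  by (subst binomial_fact) (auto simp: mult_2 power2_eq_square)

lemma fact_double_Suc:
  "fact (2 * Suc n) = 2 * of_nat (Suc n) * of_nat (2 * n + 1) * (fact (2 * n) :: 'a :: field_char_0)"
  by (simp add: algebra_simps)

text \<open>
  This is \<open>I\<^sub>0 (2 \<surd>x)\<^sup>2\<close>. Up to the factor \<open>(n!)\<^sup>2\<close>, the Domb numbers are the coefficients of its square,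
  which makes their recurrence a computation with derivations.
\<close>

definition bessel_square_fps :: "'a :: field_char_0 fps" where
  "bessel_square_fps = Abs_fps (\<lambda>j. of_nat ((2 * j) choose j) / fact j ^ 2)"

lemma fps_XD_bessel_square_fps:
  "fps_XD (fps_XD (fps_XD bessel_square_fps)) =
    fps_X * (4 * fps_XD bessel_square_fps + 2 * (bessel_square_fps :: 'a :: field_char_0 fps))"
proof (rule fps_ext)
  fix n
  show "fps_XD (fps_XD (fps_XD bessel_square_fps)) $ n =
      (fps_X * (4 * fps_XD bessel_square_fps + 2 * (bessel_square_fps :: 'a fps))) $ n"
  proof (cases n)
    case (Suc m)
    have "of_nat (Suc m) ^ 3 * bessel_square_fps $ Suc m =
        2 * of_nat (2 * m + 1) * (bessel_square_fps $ m :: 'a)"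
      unfolding bessel_square_fps_def fps_nth_Abs_fps binomial_central_fact fact_double_Suc fact_Suc
        of_nat_mult of_nat_1 power_mult_distrib
      by (simp add: divide_simps eval_nat_numeral del: of_nat_Suc of_nat_add of_nat_mult)
    then show ?thesis unfolding Suc
      by (simp add: power3_eq_cube mult.assoc del: of_nat_Suc) (simp add: algebra_simps)
  qed simp
qed

lemma bessel_square_fps_power2_nth:
  "(bessel_square_fps\<^sup>2) $ n = (of_nat (domb n) / fact n ^ 2 :: 'a :: field_char_0)"
proof -
  have "(bessel_square_fps\<^sup>2) $ n = (\<Sum>j=0..n. of_nat ((2 * j) choose j) / fact j ^ 2 *
     (of_nat ((2 * (n - j)) choose (n - j)) / fact (n - j) ^ 2) :: 'a)"
    by (simp add: power2_eq_square fps_mult_nth bessel_square_fps_def)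
  also have "\<dots> = (\<Sum>j=0..n.
      of_nat ((n choose j)\<^sup>2 * ((2 * j) choose j) * ((2 * n - 2 * j) choose (n - j))) / fact n ^ 2)"
    by (rule sum.cong) (simp_all add: binomial_fact diff_mult_distrib2 power_divide power_mult_distrib)
  finally show ?thesis by (simp add: domb_def sum_divide_distrib)
qed

lemma fps_XD_bessel_square_fps_power2:
  defines "V \<equiv> bessel_square_fps\<^sup>2 :: 'a :: field_char_0 fps"
  shows "fps_XD (fps_XD (fps_XD (fps_XD (fps_XD V)))) =
     fps_X * (20 * fps_XD (fps_XD (fps_XD V)) + 30 * fps_XD (fps_XD V) + 18 * fps_XD V + 4 * V)
     - 64 * (fps_X * (fps_X * (fps_XD V + V)))"
proof -
  define F F' F'' :: "'a fps" where "F = bessel_square_fps" and "F' = fps_XD F" and "F'' = fps_XD F'"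
  have "fps_XD F = F'" "fps_XD F' = F''" "fps_XD F'' = fps_X * (4 * F' + 2 * F)"
    using fps_XD_bessel_square_fps by (simp_all add: F_def F'_def F''_def)
  note XD_rules = fps_XD_mult fps_XD_X this
  have V_eq: "V = F * F" by (simp add: V_def F_def power2_eq_square)
  have XD_V: "fps_XD V = 2 * F * F'" unfolding V_eq by (simp add: XD_rules)
  have XD2_V: "fps_XD (fps_XD V) = 2 * F' * F' + 2 * F * F''" unfolding XD_V by (simp add: XD_rules)
  have XD3_V: "fps_XD (fps_XD (fps_XD V)) = 6 * F' * F'' + 2 * F * (fps_X * (4 * F' + 2 * F))"
    unfolding XD2_V by (simp add: XD_rules algebra_simps)
  have XD4_V: "fps_XD (fps_XD (fps_XD (fps_XD V))) = 6 * F'' * F'' + 8 * F' * (fps_X * (4 * F' + 2 * F))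
      + 2 * F * (fps_X * (4 * F' + 2 * F)) + 2 * F * (fps_X * (4 * F'' + 2 * F'))"
    unfolding XD3_V by (simp add: XD_rules algebra_simps)
  show ?thesis
    unfolding XD4_V XD3_V XD2_V XD_V V_eq by (simp add: XD_rules algebra_simps)
qed

lemma domb_recurrence:
  "of_nat (n + 2) ^ 3 * of_nat (domb (n + 2)) =
    (2 * (2 * of_nat n + 3) * (5 * of_nat n ^ 2 + 15 * of_nat n + 12) * of_nat (domb (n + 1))
     - 64 * of_nat (n + 1) ^ 3 * of_nat (domb n) :: 'a :: field_char_0)"
proof -
  define V :: "'a fps" where "V = bessel_square_fps\<^sup>2"
  define N F :: 'a where "N = of_nat n" and "F = fact n"
  have XD_V: "fps_XD (fps_XD (fps_XD (fps_XD (fps_XD V)))) =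
     fps_X * (20 * fps_XD (fps_XD (fps_XD V)) + 30 * fps_XD (fps_XD V) + 18 * fps_XD V + 4 * V)
     - 64 * (fps_X * (fps_X * (fps_XD V + V)))"
    unfolding V_def by (rule fps_XD_bessel_square_fps_power2)
  have V_recurrence: "(N + 2) ^ 5 * V $ (n + 2) =
      (20 * (N + 1) ^ 3 + 30 * (N + 1) ^ 2 + 18 * (N + 1) + 4) * V $ (n + 1) - 64 * (N + 1) * V $ n"
    using arg_cong[OF XD_V, of "\<lambda>h. h $ Suc (Suc n)"]
    by (simp add: N_def) (simp add: eval_nat_numeral algebra_simps)
  have domb_conv_V: "of_nat (domb k) = fact k ^ 2 * V $ k" for k
    by (simp add: V_def bessel_square_fps_power2_nth)
  have fact_conv: "fact (n + 1) = (N + 1) * F" "fact (n + 2) = (N + 2) * ((N + 1) * F)"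
    by (simp_all add: N_def F_def algebra_simps)
  have of_nat_conv: "of_nat (n + 1) = N + 1" "of_nat (n + 2) = N + 2"
    by (simp_all add: N_def)
  show ?thesis
    unfolding domb_conv_V fact_conv of_nat_conv F_def[symmetric] N_def[symmetric]
    using V_recurrence by algebra
qed

lemma sym_square_op_domb:
  "sym_square_op (fps_of_poly [:1, 20, 64:]) (fps_of_poly [:0, 4, 32:])
     (Abs_fps (\<lambda>n. (-1) ^ n * of_nat (domb n)) :: 'a :: field_char_0 fps) = 0"
proof (rule sym_square_op_fps_of_poly_eq_0I[where d = 2])
  fix n
  let ?S = "\<Sum>i\<le>min 2 n. sym_square_coeff (fps_of_poly [:1, 20, 64:]) (fps_of_poly [:0, 4, 32:]) n i *
      Abs_fps (\<lambda>n. (-1) ^ n * of_nat (domb n)) $ (n - i) :: 'a"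
  consider (zero) "n = 0" | (one) "n = 1" | (ge_2) m where "n = m + 2"
    by (metis One_nat_def add_2_eq_Suc' not0_implies_Suc)
  then show "?S = 0"
  proof cases
    case ge_2
    have "?S = 2 * (-1) ^ m * (of_nat (m + 2) ^ 3 * of_nat (domb (m + 2)) -
        (2 * (2 * of_nat m + 3) * (5 * of_nat m ^ 2 + 15 * of_nat m + 12) * of_nat (domb (m + 1))
         - 64 * of_nat (m + 1) ^ 3 * of_nat (domb m)))"
      unfolding ge_2 by (simp add: sym_square_coeff_def eval_nat_numeral) (simp add: algebra_simps)
    then show ?thesis unfolding domb_recurrence by simp
  qed (simp_all add: sym_square_coeff_def domb_def)
qed simp_all

definition hypergeom_fps :: "'a :: field_char_0 fps" where
  "hypergeom_fps = Abs_fps (\<lambda>n. of_nat (((3 * n) choose n) * ((2 * n) choose n)\<^sup>2))"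

lemma fact_triple_Suc:
  "fact (3 * Suc n) =
    3 * of_nat (Suc n) * of_nat (3 * n + 2) * of_nat (3 * n + 1) * (fact (3 * n) :: 'a :: field_char_0)"
  by (simp add: numeral_3_eq_3 algebra_simps)

lemma hypergeom_fps_nth:
  "hypergeom_fps $ n = fact (3 * n) * fact (2 * n) / (fact n ^ 5 :: 'a :: field_char_0)"
proof -
  have "of_nat ((3 * n) choose n) = (fact (3 * n) / (fact n * fact (2 * n)) :: 'a)"
    by (subst binomial_fact) auto
  then have "hypergeom_fps $ n =
      fact (3 * n) / (fact n * fact (2 * n)) * ((fact (2 * n) / fact n ^ 2)\<^sup>2 :: 'a)"
    by (simp add: hypergeom_fps_def binomial_central_fact)
  then show ?thesis by (simp add: eval_nat_numeral)
qed

lemma sym_square_op_hypergeom: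
  "sym_square_op (fps_of_poly [:4, - 432:]) (fps_of_poly [:0, - 48:])
     (hypergeom_fps :: 'a :: field_char_0 fps) = 0"
proof (rule sym_square_op_fps_of_poly_eq_0I[where d = 1])
  fix n
  let ?c = "sym_square_coeff (fps_of_poly [:4, - 432:]) (fps_of_poly [:0, - 48:]) n"
  show "(\<Sum>i\<le>min 1 n. ?c i * (hypergeom_fps :: 'a fps) $ (n - i)) = 0"
  proof (cases n)
    case (Suc m)
    have "of_nat (Suc m) ^ 3 * hypergeom_fps $ Suc m =
        6 * of_nat (2 * m + 1) * of_nat (3 * m + 1) * of_nat (3 * m + 2) * (hypergeom_fps $ m :: 'a)"
      unfolding hypergeom_fps_nth fact_double_Suc fact_triple_Suc fact_Suc of_nat_mult of_nat_1
        power_mult_distrib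
      by (simp add: divide_simps eval_nat_numeral del: of_nat_Suc of_nat_add of_nat_mult)
    then show ?thesis unfolding Suc by (simp add: sym_square_coeff_def) algebra
  qed (simp add: sym_square_coeff_def)
qed simp_all

section \<open>Eta quotients of level 6\<close>

lemma level_6_relations:
  fixes z b W M :: "'a :: field_char_0 fps"
  defines "s \<equiv> sigma_fps 1"
  assumes z: "z = 1 - 4 * s 1 + 16 * s 2 + 12 * s 3 - 48 * s 6"
    and b: "b = s 1 - s 2 - 3 * s 3 + 3 * s 6"
    and W: "W = 1 + 6 * s 1 - 12 * s 2 + 18 * s 3 - 36 * s 6"
    and M: "M = 4 * s 2 - 4 * s 1 - 12 * s 3 + 12 * s 6"
  shows "fps_XD z = z * M" and "fps_XD b = b * (M + W)"
    and "W\<^sup>2 = (z + 4 * b) * (z + 16 * b)"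
    and "2 * fps_XD M = M\<^sup>2 - 8 * b * z - 64 * b\<^sup>2"
    and "fps_XD W = W * M + 10 * b * z + 64 * b\<^sup>2"
proof -
  let ?P = "eis_P_fps :: nat \<Rightarrow> 'a fps" and ?Q = "eis_Q_fps :: nat \<Rightarrow> 'a fps"
  have Ramanujan: "12 * fps_XD (?P 1) = (?P 1)\<^sup>2 - ?Q 1" "12 * fps_XD (?P 2) = 2 * ((?P 2)\<^sup>2 - ?Q 2)"
    "12 * fps_XD (?P 3) = 3 * ((?P 3)\<^sup>2 - ?Q 3)" "12 * fps_XD (?P 6) = 6 * ((?P 6)\<^sup>2 - ?Q 6)"
    using Ramanujan_eis_P_fps[of 1, where ?'a = 'a] Ramanujan_eis_P_fps[of 2, where ?'a = 'a]
      Ramanujan_eis_P_fps[of 3, where ?'a = 'a] Ramanujan_eis_P_fps[of 6, where ?'a = 'a] by simp_all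
  have levels: "5 * (?P 1 - 2 * ?P 2)\<^sup>2 = ?Q 1 + 4 * ?Q 2" "5 * (?P 3 - 2 * ?P 6)\<^sup>2 = ?Q 3 + 4 * ?Q 6"
    "5 * (?P 1 - 3 * ?P 3)\<^sup>2 = 2 * (?Q 1 + 9 * ?Q 3)" "5 * (?P 2 - 3 * ?P 6)\<^sup>2 = 2 * (?Q 2 + 9 * ?Q 6)"
    "5 * (?P 1 - ?P 2 - ?P 3 - ?P 6)\<^sup>2 = 2 * (?Q 1 - ?Q 2 - ?Q 3 + 11 * ?Q 6)"
    using eis_fps_level_2[of 1, where ?'a = 'a] eis_fps_level_2[of 3, where ?'a = 'a]
      eis_fps_level_3[of 1, where ?'a = 'a] eis_fps_level_3[of 2, where ?'a = 'a]
      eis_fps_level_6[of 1, where ?'a = 'a] by simp_all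
  have in_P: "6 * z = ?P 1 - 4 * ?P 2 - 3 * ?P 3 + 12 * ?P 6" "24 * b = ?P 2 - ?P 1 + 3 * ?P 3 - 3 * ?P 6"
    "4 * W = 2 * ?P 2 - ?P 1 - 3 * ?P 3 + 6 * ?P 6" "6 * M = ?P 1 - ?P 2 + 3 * ?P 3 - 3 * ?P 6"
    by (simp_all add: z b W M s_def eis_P_fps_def)
  have "6 * fps_XD z = fps_XD (?P 1) - 4 * fps_XD (?P 2) - 3 * fps_XD (?P 3) + 12 * fps_XD (?P 6)"
    "24 * fps_XD b = fps_XD (?P 2) - fps_XD (?P 1) + 3 * fps_XD (?P 3) - 3 * fps_XD (?P 6)"
    "4 * fps_XD W = 2 * fps_XD (?P 2) - fps_XD (?P 1) - 3 * fps_XD (?P 3) + 6 * fps_XD (?P 6)"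
    "6 * fps_XD M = fps_XD (?P 1) - fps_XD (?P 2) + 3 * fps_XD (?P 3) - 3 * fps_XD (?P 6)"
    using in_P[THEN arg_cong, of fps_XD] by (simp_all add: fps_XD_mult)
  note relations = this in_P Ramanujan levels
  show "fps_XD z = z * M" "fps_XD b = b * (M + W)" "W\<^sup>2 = (z + 4 * b) * (z + 16 * b)"
    "2 * fps_XD M = M\<^sup>2 - 8 * b * z - 64 * b\<^sup>2" "fps_XD W = W * M + 10 * b * z + 64 * b\<^sup>2"
    using relations by algebra+
qed

text \<open>The logarithm of \<open>(1 - q) (1 - q\<^sup>2) (1 - q\<^sup>3) \<dots>\<close>.\<close>

definition log_euler_fps :: "'a :: field_char_0 fps" where
  "log_euler_fps = - lambert_fps 0 (\<lambda>k. 1 / of_nat k)"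

lemma log_euler_fps_nth_0 [simp]: "log_euler_fps $ 0 = 0"
  by (simp add: log_euler_fps_def)

lemma fps_XD_log_euler_fps: "fps_XD log_euler_fps = - (sigma_fps 1 1 :: 'a :: field_char_0 fps)"
proof -
  have "lambert_fps 1 (\<lambda>k. of_nat k * (1 / of_nat k)) = (sigma_fps 1 1 :: 'a fps)"
    by (auto simp: fps_eq_iff sigma_fps_def lambert_fps_nth dvd_div_eq_0_iff intro!: sum.cong)
  then show ?thesis by (simp add: log_euler_fps_def fps_XD_lambert_fps)
qed

definition euler_quotient_fps :: "nat set \<Rightarrow> (nat \<Rightarrow> int) \<Rightarrow> 'a :: field_char_0 fps" where
  "euler_quotient_fps K e = fps_exp 1 oo (\<Sum>k\<in>K. of_int (e k) * (log_euler_fps oo fps_X ^ k))"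

lemma euler_quotient_fps_nth_0 [simp]: "euler_quotient_fps K e $ 0 = 1"
  by (simp add: euler_quotient_fps_def)

lemma fps_XD_of_int_mult: "fps_XD (of_int c * f) = of_int c * (fps_XD f :: 'a :: comm_ring_1 fps)"
  by (simp flip: fps_of_int)

lemma fps_XD_sum: "fps_XD (\<Sum>k\<in>K. f k) = (\<Sum>k\<in>K. fps_XD (f k :: 'a :: comm_ring_1 fps))"
  by (simp add: fps_eq_iff fps_sum_nth sum_distrib_left)

lemma fps_XD_euler_quotient_fps:
  assumes "0 \<notin> K"
  shows "fps_XD (euler_quotient_fps K e) =
    euler_quotient_fps K e * - (\<Sum>k\<in>K. of_int (e k * int k) * (sigma_fps 1 k :: 'a :: field_char_0 fps))"
proof -
  let ?L = "\<lambda>k. log_euler_fps oo fps_X ^ k :: 'a fps"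
  let ?S = "\<Sum>k\<in>K. of_int (e k) * ?L k"
  have "fps_XD (?L k) = - (of_nat k * sigma_fps 1 k)" if "k \<in> K" for k
  proof -
    have "k > 0" using assms that by (cases k) auto
    then show ?thesis
      by (simp add: fps_XD_compose_X_power fps_XD_log_euler_fps fps_compose_uminus sigma_fps_compose_X_power
          del: One_nat_def)
  qed
  then have "fps_XD ?S = - (\<Sum>k\<in>K. of_int (e k * int k) * sigma_fps 1 k)"
    by (simp add: fps_XD_sum fps_XD_of_int_mult sum_negf[symmetric] mult.assoc)
  moreover have "fps_XD (fps_exp 1 oo ?S) = (fps_exp 1 oo ?S) * fps_XD ?S"
    by (simp add: fps_XD_def fps_compose_deriv fps_sum_nth mult_ac)
  ultimately show ?thesis by (simp add: euler_quotient_fps_def)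
qed

definition z_fps :: "complex fps" where
  "z_fps = euler_quotient_fps {1, 2, 3, 6} (\<lambda>k. if odd k then 4 else - 2)"

definition y_fps :: "complex fps" where
  "y_fps = fps_X * euler_quotient_fps {1, 2, 3, 6} (\<lambda>k. if odd k then - 6 else 6)"

definition dlog_z :: "complex fps" where
  "dlog_z = 4 * sigma_fps 1 2 - 4 * sigma_fps 1 1 - 12 * sigma_fps 1 3 + 12 * sigma_fps 1 6"

definition dlog_y :: "complex fps" where
  "dlog_y = 1 + 6 * sigma_fps 1 1 - 12 * sigma_fps 1 2 + 18 * sigma_fps 1 3 - 36 * sigma_fps 1 6"

lemma fps_XD_z_fps: "fps_XD z_fps = z_fps * dlog_z"
  by (simp add: z_fps_def dlog_z_def fps_XD_euler_quotient_fps algebra_simps)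

lemma fps_XD_y_fps: "fps_XD y_fps = y_fps * dlog_y"
  by (simp add: y_fps_def dlog_y_def fps_XD_mult fps_XD_X fps_XD_euler_quotient_fps algebra_simps)

lemma z_fps_nth_0 [simp]: "z_fps $ 0 = 1" and y_fps_nth_0 [simp]: "y_fps $ 0 = 0"
  and dlog_y_nth_0 [simp]: "dlog_y $ 0 = 1" and dlog_z_nth_0 [simp]: "dlog_z $ 0 = 0"
  by (simp_all add: z_fps_def y_fps_def dlog_y_def dlog_z_def)

lemma z_fps_eq:
  "z_fps = 1 - 4 * sigma_fps 1 1 + 16 * sigma_fps 1 2 + 12 * sigma_fps 1 3 - 48 * sigma_fps 1 6" (is "_ = ?z")
proof (rule fps_XD_eq_mult_unique)
  show "fps_XD ?z = ?z * dlog_z" by (rule level_6_relations(1)[OF refl refl dlog_y_def dlog_z_def])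
  show "dlog_z $ 0 = of_nat 0" by simp
qed (simp_all add: fps_XD_z_fps)

lemma y_z_fps_eq:
  "y_fps * z_fps = sigma_fps 1 1 - sigma_fps 1 2 - 3 * sigma_fps 1 3 + 3 * sigma_fps 1 6" (is "_ = ?b")
proof (rule fps_XD_eq_mult_unique)
  show "fps_XD (y_fps * z_fps) = y_fps * z_fps * (dlog_z + dlog_y)"
    by (simp add: fps_XD_mult fps_XD_y_fps fps_XD_z_fps algebra_simps)
  show "fps_XD ?b = ?b * (dlog_z + dlog_y)"
    by (rule level_6_relations(2)[OF refl refl dlog_y_def dlog_z_def])
  show "(dlog_z + dlog_y) $ 0 = of_nat 1" by simp
  have "sigma_fps 1 1 $ 1 = (1 :: complex)" "i > 1 \<Longrightarrow> sigma_fps 1 i $ 1 = (0 :: complex)" for i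
    by (auto simp: sigma_fps_nth)
  then show "(y_fps * z_fps) $ 1 = ?b $ 1"
    by (simp add: fps_mult_nth_1 y_fps_def)
qed

lemma dlog_y_squared_conv_z_fps:
    "dlog_y\<^sup>2 = (z_fps + 4 * (y_fps * z_fps)) * (z_fps + 16 * (y_fps * z_fps))"
  and fps_XD_dlog_z:
    "2 * fps_XD dlog_z = dlog_z\<^sup>2 - 8 * (y_fps * z_fps) * z_fps - 64 * (y_fps * z_fps)\<^sup>2"
  and fps_XD_dlog_y:
    "fps_XD dlog_y = dlog_y * dlog_z + 10 * (y_fps * z_fps) * z_fps + 64 * (y_fps * z_fps)\<^sup>2"
  by (rule level_6_relations(3-5)[OF z_fps_eq y_z_fps_eq dlog_y_def dlog_z_def])+

definition x_fps :: "complex fps" where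
  "x_fps = y_fps * inverse (1 + 4 * y_fps)"

definition Z_fps :: "complex fps" where
  "Z_fps = (1 + 4 * y_fps) * z_fps"

definition dlog_Z :: "complex fps" where
  "dlog_Z = dlog_z + 4 * x_fps * dlog_y"

lemma x_fps_nth_0 [simp]: "x_fps $ 0 = 0" and Z_fps_nth_0 [simp]: "Z_fps $ 0 = 1"
  by (simp_all add: x_fps_def Z_fps_def)

lemma Z_fps_eq_eis_P_fps: "2 * Z_fps = 3 * eis_P_fps 6 - eis_P_fps 2"
  using y_z_fps_eq z_fps_eq unfolding Z_fps_def eis_P_fps_def by algebra

lemma y_fps_conv_x_fps: "(1 + 4 * y_fps) * (1 - 4 * x_fps) = 1"
  and x_fps_mult: "x_fps * (1 + 4 * y_fps) = y_fps"
proof -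
  have "inverse (1 + 4 * y_fps) * (1 + 4 * y_fps) = 1" by (rule inverse_mult_eq_1) simp
  then show "x_fps * (1 + 4 * y_fps) = y_fps" "(1 + 4 * y_fps) * (1 - 4 * x_fps) = 1"
    unfolding x_fps_def by algebra+
qed

lemma z_fps_conv_Z_fps: "z_fps = Z_fps * (1 - 4 * x_fps)"
  and y_z_fps_conv_Z_fps: "y_fps * z_fps = x_fps * Z_fps"
  unfolding Z_fps_def using y_fps_conv_x_fps x_fps_mult by algebra+

lemma fps_XD_x_fps: "fps_XD x_fps = x_fps * (dlog_y * (1 - 4 * x_fps))"
proof -
  have "fps_XD x_fps * (1 + 4 * y_fps) + 4 * x_fps * (y_fps * dlog_y) = y_fps * dlog_y"
    using arg_cong[OF x_fps_mult, of fps_XD] by (simp add: fps_XD_mult fps_XD_y_fps algebra_simps)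
  then show ?thesis using x_fps_mult y_fps_conv_x_fps by algebra
qed

lemma fps_XD_Z_fps: "fps_XD Z_fps = Z_fps * dlog_Z"
proof -
  have "fps_XD Z_fps = 4 * (y_fps * dlog_y) * z_fps + (1 + 4 * y_fps) * (z_fps * dlog_z)"
    by (simp add: Z_fps_def fps_XD_mult fps_XD_y_fps fps_XD_z_fps)
  then show ?thesis unfolding Z_fps_def dlog_Z_def using x_fps_mult by algebra
qed

lemma dlog_y_squared: "dlog_y\<^sup>2 = Z_fps\<^sup>2 * (1 + 12 * x_fps)"
  using dlog_y_squared_conv_z_fps y_z_fps_conv_Z_fps z_fps_conv_Z_fps by algebra

lemma fps_XD_dlog_Z: "2 * fps_XD dlog_Z = dlog_Z\<^sup>2 + 96 * Z_fps\<^sup>2 * x_fps\<^sup>2 * (1 - 4 * x_fps)"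
proof -
  note in_Z = fps_XD_dlog_z[unfolded y_z_fps_conv_Z_fps, unfolded z_fps_conv_Z_fps]
    fps_XD_dlog_y[unfolded y_z_fps_conv_Z_fps, unfolded z_fps_conv_Z_fps]
  have "2 * fps_XD dlog_Z = 2 * fps_XD dlog_z + 8 * fps_XD x_fps * dlog_y + 8 * x_fps * fps_XD dlog_y"
    by (simp add: dlog_Z_def fps_XD_mult algebra_simps)
  also have "\<dots> = dlog_Z\<^sup>2 + 96 * Z_fps\<^sup>2 * x_fps\<^sup>2 * (1 - 4 * x_fps)
      + (8 * x_fps - 48 * x_fps\<^sup>2) * (dlog_y\<^sup>2 - Z_fps\<^sup>2 * (1 + 12 * x_fps))"
    unfolding in_Z fps_XD_x_fps dlog_Z_def by algebra
  finally show ?thesis unfolding dlog_y_squared by simp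
qed

lemma fps_of_poly_pCons_compose:
  fixes v :: "'a :: idom fps"
  assumes "v $ 0 = 0"
  shows "fps_of_poly (pCons c p) oo v = fps_const c + v * (fps_of_poly p oo v)"
  using assms by (simp add: fps_of_poly_pCons fps_compose_add_distrib fps_compose_mult_distrib mult.commute)

lemma weight_2_system_y_z:
  "weight_2_system y_fps dlog_y z_fps dlog_z (fps_of_poly [:1, 20, 64:]) (fps_of_poly [:0, 4, 32:])"
proof
  show "dlog_y\<^sup>2 = z_fps\<^sup>2 * (fps_of_poly [:1, 20, 64:] oo y_fps)"
    by (simp add: dlog_y_squared_conv_z_fps fps_of_poly_pCons_compose flip: numeral_fps_const) algebra
  show "2 * fps_XD dlog_z = dlog_z\<^sup>2 - 2 * z_fps\<^sup>2 * (fps_of_poly [:0, 4, 32:] oo y_fps)"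
    by (simp add: fps_XD_dlog_z fps_of_poly_pCons_compose flip: numeral_fps_const) algebra
qed (simp_all add: fps_XD_y_fps fps_XD_z_fps)

lemma weight_2_system_x_Z:
  "weight_2_system x_fps (dlog_y * (1 - 4 * x_fps)) Z_fps dlog_Z
     (fps_of_poly [:1, 4, - 80, 192:]) (fps_of_poly [:0, 0, - 48, 192:])"
proof
  show "(dlog_y * (1 - 4 * x_fps))\<^sup>2 = Z_fps\<^sup>2 * (fps_of_poly [:1, 4, - 80, 192:] oo x_fps)"
    using dlog_y_squared
    by (simp add: fps_of_poly_pCons_compose flip: numeral_fps_const neg_numeral_fps_const) algebra
  show "2 * fps_XD dlog_Z = dlog_Z\<^sup>2 - 2 * Z_fps\<^sup>2 * (fps_of_poly [:0, 0, - 48, 192:] oo x_fps)"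
    by (simp add: fps_XD_dlog_Z fps_of_poly_pCons_compose
        flip: numeral_fps_const neg_numeral_fps_const) algebra
qed (simp_all add: fps_XD_x_fps fps_XD_Z_fps)

lemma weight_2_system_cubic_x_Z:
  "weight_2_system (x_fps\<^sup>2 * (1 - 4 * x_fps)) (2 * dlog_y * (1 - 6 * x_fps)) Z_fps dlog_Z
     (fps_of_poly [:4, - 432:]) (fps_of_poly [:0, - 48:])"
proof
  show "fps_XD (x_fps\<^sup>2 * (1 - 4 * x_fps)) = x_fps\<^sup>2 * (1 - 4 * x_fps) * (2 * dlog_y * (1 - 6 * x_fps))"
    by (simp add: power2_eq_square fps_XD_mult fps_XD_x_fps) algebra
  show "(2 * dlog_y * (1 - 6 * x_fps))\<^sup>2 = Z_fps\<^sup>2 * (fps_of_poly [:4, - 432:] oo x_fps\<^sup>2 * (1 - 4 * x_fps))"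
    using dlog_y_squared
    by (simp add: fps_of_poly_pCons_compose flip: numeral_fps_const neg_numeral_fps_const) algebra
  show "2 * fps_XD dlog_Z = dlog_Z\<^sup>2 - 2 * Z_fps\<^sup>2 * (fps_of_poly [:0, - 48:] oo x_fps\<^sup>2 * (1 - 4 * x_fps))"
    by (simp add: fps_XD_dlog_Z fps_of_poly_pCons_compose flip: numeral_fps_const neg_numeral_fps_const)
qed (simp_all add: fps_XD_Z_fps)

section \<open>Analytic eta quotients\<close>

lemma summable_power_mult_geometric:
  fixes r :: real
  assumes "\<bar>r\<bar> < 1"
  shows "summable (\<lambda>n. real (Suc n) ^ e * r ^ n)"
proof (rule summable_in_conv_radius)
  have "(\<lambda>n. (real (Suc n) / real (Suc (Suc n))) ^ e) \<longlonglongrightarrow> 1 ^ e"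
    by (intro tendsto_power LIMSEQ_Suc[OF LIMSEQ_n_over_Suc_n])
  then have "conv_radius (\<lambda>n. real (Suc n) ^ e) = 1"
    by (intro conv_radius_ratio_limit_nonzero[of _ 1])
       (simp_all add: one_ereal_def norm_power power_divide del: of_nat_Suc)
  then show "ereal (norm r) < conv_radius (\<lambda>n. real (Suc n) ^ e)"
    using assms by simp
qed

lemma has_sum_divisors:
  fixes c :: "nat \<Rightarrow> nat \<Rightarrow> 'a :: {topological_comm_monoid_add, t3_space}"
  assumes "((\<lambda>(j, k). c (Suc j) (Suc k)) has_sum T) UNIV"
  shows "((\<lambda>n. \<Sum>m | m dvd n. c m (n div m)) has_sum T) {0<..}"
proof (rule has_sum_SigmaD)
  have "((\<lambda>(n, m). c m (n div m)) has_sum T) (Sigma {0<..} (\<lambda>n. {m. m dvd n})) \<longleftrightarrow>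
      ((\<lambda>(j, k). c (Suc j) (Suc k)) has_sum T) UNIV"
  proof (rule has_sum_reindex_bij_witness[where j = "\<lambda>(n, m). (m - 1, n div m - 1)"
        and i = "\<lambda>(j, k). (Suc j * Suc k, Suc j)"])
    fix a :: "nat \<times> nat" assume "a \<in> Sigma {0<..} (\<lambda>n. {m. m dvd n})"
    then obtain m k where "a = (m * k, m)" "m > 0" "k > 0" by (auto elim!: dvdE)
    then show "(case case a of (n, m) \<Rightarrow> (m - 1, n div m - 1) of (j, k) \<Rightarrow> (Suc j * Suc k, Suc j)) = a"
      and "(case case a of (n, m) \<Rightarrow> (m - 1, n div m - 1) of (j, k) \<Rightarrow> c (Suc j) (Suc k)) =
        (case a of (n, m) \<Rightarrow> c m (n div m))"
      by (simp_all del: mult_Suc mult_Suc_right)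
  qed (auto simp del: mult_Suc mult_Suc_right)
  with assms show "((\<lambda>(n, m). c m (n div m)) has_sum T) (Sigma {0<..} (\<lambda>n. {m. m dvd n}))" by simp
qed (auto intro!: has_sum_finiteI)

lemma summable_on_product_geometric:
  fixes c :: "nat \<Rightarrow> nat \<Rightarrow> 'a :: {banach, real_normed_field}"
  assumes "norm q < 1" and c: "\<And>j k. norm (c j k) \<le> C * real (Suc j) ^ e"
  shows "(\<lambda>(j, k). c j k * q ^ (Suc j * Suc k)) summable_on UNIV"
proof (rule abs_summable_summable, rule summable_on_comparison_test)
  let ?r = "norm q"
  have "C \<ge> 0" using order_trans[OF norm_ge_zero c[of 0 0]] by simp
  show "(\<lambda>(j, k). C * real (Suc j) ^ e * ?r ^ j * ?r ^ k) summable_on UNIV"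
    unfolding UNIV_Times_UNIV[symmetric]
  proof (rule summable_on_SigmaI)
    show nonneg: "(case (j, k) of (j, k) \<Rightarrow> C * real (Suc j) ^ e * ?r ^ j * ?r ^ k) \<ge> 0" for j k
      using \<open>C \<ge> 0\<close> by simp
    show "((\<lambda>k. case (j, k) of (j, k) \<Rightarrow> C * real (Suc j) ^ e * ?r ^ j * ?r ^ k) has_sum
        C * real (Suc j) ^ e * ?r ^ j * (1 / (1 - ?r))) UNIV" for j
      using nonneg[of j] sums_mult[OF geometric_sums[of ?r]] assms(1)
      by (intro sums_nonneg_imp_has_sum) simp_all
    have "summable (\<lambda>j. C * (real (Suc j) ^ e * ?r ^ j) * (1 / (1 - ?r)))"
      using assms(1) by (intro summable_mult summable_mult2 summable_power_mult_geometric) simp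
    then show "(\<lambda>j. C * real (Suc j) ^ e * ?r ^ j * (1 / (1 - ?r))) summable_on UNIV"
      using \<open>C \<ge> 0\<close> assms(1) by (intro summable_nonneg_imp_summable_on) (simp_all add: mult.assoc)
  qed
  fix p :: "nat \<times> nat"
  obtain j k where p: "p = (j, k)" by fastforce
  have "?r ^ (Suc j * Suc k) \<le> ?r ^ (j + k)"
    using assms(1) by (intro power_decreasing) simp_all
  with c have "norm (c j k) * ?r ^ (Suc j * Suc k) \<le> C * real (Suc j) ^ e * ?r ^ (j + k)"
    by (intro mult_mono) (simp_all add: \<open>C \<ge> 0\<close>)
  then show "norm (case p of (j, k) \<Rightarrow> c j k * q ^ (Suc j * Suc k)) \<le>
      (case p of (j, k) \<Rightarrow> C * real (Suc j) ^ e * ?r ^ j * ?r ^ k)"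
    unfolding p prod.case norm_mult norm_power mult.assoc power_add .
qed auto

lemma has_sum_iterated_sums:
  fixes f :: "nat \<times> nat \<Rightarrow> 'a :: banach"
  assumes total: "(f has_sum T) UNIV" and rows: "\<And>j. (\<lambda>k. f (j, k)) sums g j"
  shows "(g has_sum T) UNIV"
proof (rule has_sum_SigmaD)
  show "(f has_sum T) (UNIV \<times> UNIV)" using total by simp
  fix j
  have "f summable_on Pair j ` UNIV"
    by (rule summable_on_subset_banach[OF has_sum_imp_summable[OF total]]) simp
  then have "(\<lambda>k. f (j, k)) summable_on UNIV"
    by (subst (asm) summable_on_reindex) (simp_all add: inj_on_def o_def)
  then obtain S where "((\<lambda>k. f (j, k)) has_sum S) UNIV"
    unfolding summable_on_def by blast
  with sums_unique2[OF has_sum_imp_sums[OF this] rows]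
  show "((\<lambda>k. f (j, k)) has_sum g j) UNIV" by simp
qed

lemma lambert_fps_sums:
  fixes f :: "nat \<Rightarrow> 'a :: {banach, real_normed_field}"
  assumes "norm q < 1" and f: "\<And>k. norm (f k) \<le> C"
    and inner: "\<And>j. (\<lambda>k. f (Suc k) * (q ^ Suc j) ^ Suc k) sums h j"
  shows "(\<lambda>n. lambert_fps e f $ n * q ^ n) sums (\<Sum>j. of_nat (Suc j) ^ e * h j)"
    and "summable (\<lambda>j. of_nat (Suc j) ^ e * h j)"
proof -
  let ?c = "\<lambda>m k. of_nat m ^ e * f k * q ^ (m * k)"
  have "(\<lambda>(j, k). ?c (Suc j) (Suc k)) summable_on UNIV"
    using assms(1)
    by (rule summable_on_product_geometric[where C = C and e = e])
      (use f in \<open>simp add: norm_mult norm_power mult.commute mult_left_mono del: of_nat_Suc\<close>)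
  then obtain T where total: "((\<lambda>(j, k). ?c (Suc j) (Suc k)) has_sum T) UNIV"
    unfolding summable_on_def by blast
  have "((\<lambda>j. of_nat (Suc j) ^ e * h j) has_sum T) UNIV"
  proof (rule has_sum_iterated_sums[OF total])
    fix j
    have "(\<lambda>k. of_nat (Suc j) ^ e * (f (Suc k) * (q ^ Suc j) ^ Suc k)) sums
        (of_nat (Suc j) ^ e * h j)"
      by (intro sums_mult inner)
    then show "(\<lambda>k. case (j, k) of (j, k) \<Rightarrow> ?c (Suc j) (Suc k)) sums (of_nat (Suc j) ^ e * h j)"
      by (simp add: power_mult mult.assoc del: power_Suc mult_Suc mult_Suc_right of_nat_Suc)
  qed
  then have outer: "(\<lambda>j. of_nat (Suc j) ^ e * h j) sums T" by (rule has_sum_imp_sums)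
  then show "summable (\<lambda>j. of_nat (Suc j) ^ e * h j)" by (rule sums_summable)
  have "((\<lambda>n. \<Sum>m | m dvd n. ?c m (n div m)) has_sum T) {0<..}"
    using total by (rule has_sum_divisors)
  also have "?this \<longleftrightarrow> ((\<lambda>n. lambert_fps e f $ n * q ^ n) has_sum T) UNIV"
    by (rule has_sum_cong_neutral) (auto simp: lambert_fps_nth sum_distrib_right)
  finally have "(\<lambda>n. lambert_fps e f $ n * q ^ n) sums T" by (rule has_sum_imp_sums)
  then show "(\<lambda>n. lambert_fps e f $ n * q ^ n) sums (\<Sum>j. of_nat (Suc j) ^ e * h j)"
    using sums_unique[OF outer] by simp
qed

lemma norm_power_Suc_less_1: "norm (q ^ Suc j) < 1" if "norm (q :: 'a :: real_normed_div_algebra) < 1"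
  using that by (simp add: norm_power power_less_one_iff del: power_Suc)

lemma eventually_norm_less_1: "\<forall>\<^sub>F q :: complex in nhds 0. norm q < 1"
  by (rule eventually_nhds_in_open[of "ball 0 1", THEN eventually_mono]) auto

lemma sigma_fps_sums:
  fixes q :: "'a :: {banach, real_normed_field}"
  assumes "norm q < 1"
  shows "(\<lambda>n. sigma_fps e 1 $ n * q ^ n) sums (\<Sum>j. of_nat (Suc j) ^ e * (q ^ Suc j / (1 - q ^ Suc j)))"
  unfolding sigma_fps_def
proof (rule lambert_fps_sums(1)[OF assms, where C = 1])
  show "(\<lambda>k. of_bool (1 dvd Suc k) * (q ^ Suc j) ^ Suc k) sums (q ^ Suc j / (1 - q ^ Suc j))" for j
    using sums_mult[OF geometric_sums[OF norm_power_Suc_less_1[OF assms]], of "q ^ Suc j"] by simp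
qed simp

lemma eis_P_has_fps_expansion: "eis_P has_fps_expansion eis_P_fps 1"
proof -
  have "(\<lambda>q. \<Sum>j. of_nat (Suc j) ^ 1 * (q ^ Suc j / (1 - q ^ Suc j))) has_fps_expansion
      (sigma_fps 1 1 :: complex fps)"
    by (rule has_fps_expansionI, rule eventually_mono[OF eventually_norm_less_1], rule sigma_fps_sums)
  then show ?thesis
    unfolding eis_P_def[abs_def] eis_P_fps_def
    by (intro fps_expansion_intros) (simp add: mult.assoc)
qed

lemma has_fps_expansion_compose_power:
  assumes "f has_fps_expansion F" "k > 0"
  shows "(\<lambda>q. f (q ^ k)) has_fps_expansion (F oo fps_X ^ k :: complex fps)"
  using has_fps_expansion_compose[OF assms(1) has_fps_expansion_fps_X_power[of k]] assms(2)
  by (simp add: o_def)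

lemma log_euler_fps_sums:
  fixes q :: complex
  assumes "norm q < 1"
  shows "(\<lambda>n. log_euler_fps $ n * q ^ n) sums (\<Sum>j. Ln (1 - q ^ Suc j))"
    and "summable (\<lambda>j. Ln (1 - q ^ Suc j))"
proof -
  have "(\<lambda>k. 1 / of_nat (Suc k) * (q ^ Suc j) ^ Suc k) sums - Ln (1 - q ^ Suc j)" for j
  proof -
    have "(\<lambda>n. - ((q ^ Suc j) ^ n) / of_nat n) sums Ln (1 - q ^ Suc j)"
      using Ln_series'[of "- (q ^ Suc j)"] norm_power_Suc_less_1[OF assms, of j] by (simp del: power_Suc)
    then have "(\<lambda>n. (q ^ Suc j) ^ n / of_nat n) sums - Ln (1 - q ^ Suc j)"
      using sums_minus by fastforce
    then have "(\<lambda>k. (q ^ Suc j) ^ Suc k / of_nat (Suc k)) sums - Ln (1 - q ^ Suc j)"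
      by (subst sums_Suc_iff) simp
    then show ?thesis by simp
  qed
  note sums = lambert_fps_sums[where e = 0 and C = 1 and f = "\<lambda>k. 1 / of_nat k", OF assms _ this]
  have "norm (1 / of_nat k :: complex) \<le> 1" for k
    by (cases k) (simp_all add: norm_divide del: of_nat_Suc)
  note sums = sums[OF this]
  show summable_Ln: "summable (\<lambda>j. Ln (1 - q ^ Suc j))"
    using sums(2) by (simp add: summable_minus_iff del: power_Suc)
  show "(\<lambda>n. log_euler_fps $ n * q ^ n) sums (\<Sum>j. Ln (1 - q ^ Suc j))"
    using sums_minus[OF sums(1)] suminf_minus[OF summable_Ln] by (simp add: log_euler_fps_def
        del: power_Suc)
qed

lemma log_euler_fps_has_fps_expansion: "(\<lambda>q. \<Sum>j. Ln (1 - q ^ Suc j)) has_fps_expansion log_euler_fps"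
  by (rule has_fps_expansionI, rule eventually_mono[OF eventually_norm_less_1], rule log_euler_fps_sums)

lemma prodinf_euler_quotient:
  fixes q :: complex
  assumes "norm q < 1" "0 \<notin> K"
  shows "(\<Prod>j. \<Prod>k\<in>K. (1 - q ^ (k * Suc j)) powi e k) =
    exp (\<Sum>k\<in>K. of_int (e k) * (\<Sum>j. Ln (1 - (q ^ k) ^ Suc j)))"
proof -
  have norm: "norm (q ^ k) < 1" if "k \<in> K" for k
    using assms that by (cases "k = 0") (auto simp: norm_power power_less_one_iff)
  have "(1 - q ^ (k * Suc j)) powi e k = exp (of_int (e k) * Ln (1 - (q ^ k) ^ Suc j))" if "k \<in> K" for j k
  proof -
    have "1 - (q ^ k) ^ Suc j \<noteq> 0"
      using norm_power_Suc_less_1[OF norm[OF that], of j] by auto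
    then show ?thesis by (simp add: power_mult flip: exp_power_int del: power_Suc mult_Suc_right)
  qed
  then have "(\<Prod>j. \<Prod>k\<in>K. (1 - q ^ (k * Suc j)) powi e k) =
      (\<Prod>j. exp (\<Sum>k\<in>K. of_int (e k) * Ln (1 - (q ^ k) ^ Suc j)))"
    by (cases "finite K") (simp_all add: exp_sum)
  also have "\<dots> = exp (\<Sum>k\<in>K. of_int (e k) * (\<Sum>j. Ln (1 - (q ^ k) ^ Suc j)))"
  proof -
    have "(\<lambda>j. \<Sum>k\<in>K. of_int (e k) * Ln (1 - (q ^ k) ^ Suc j)) sums
        (\<Sum>k\<in>K. of_int (e k) * (\<Sum>j. Ln (1 - (q ^ k) ^ Suc j)))"
      by (intro sums_sum sums_mult summable_sums log_euler_fps_sums(2) norm)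
    then show ?thesis by (simp add: prodinf_exp sums_iff del: power_Suc)
  qed
  finally show ?thesis .
qed

lemma euler_quotient_has_fps_expansion:
  assumes "finite K" "0 \<notin> K"
  shows "(\<lambda>q :: complex. \<Prod>j. \<Prod>k\<in>K. (1 - q ^ (k * Suc j)) powi e k) has_fps_expansion
    euler_quotient_fps K e"
proof -
  let ?L = "\<lambda>q. \<Sum>k\<in>K. of_int (e k) * (\<Sum>j. Ln (1 - (q ^ k) ^ Suc j))"
  have "?L has_fps_expansion (\<Sum>k\<in>K. fps_const (of_int (e k)) * (log_euler_fps oo fps_X ^ k))"
    using assms by (intro has_fps_expansion_sum has_fps_expansion_cmult_left
        has_fps_expansion_compose_power[OF log_euler_fps_has_fps_expansion]) (metis gr0I)
  from has_fps_expansion_compose[OF has_fps_expansion_exp1 this]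
  have "(exp \<circ> ?L) has_fps_expansion euler_quotient_fps K e"
    using assms by (simp add: euler_quotient_fps_def fps_of_int fps_sum_nth)
  moreover have "\<forall>\<^sub>F q in nhds 0. (exp \<circ> ?L) q = (\<Prod>j. \<Prod>k\<in>K. (1 - q ^ (k * Suc j)) powi e k)"
    using eventually_norm_less_1
    by eventually_elim (simp add: prodinf_euler_quotient assms del: power_Suc mult_Suc_right)
  ultimately show ?thesis
    unfolding has_fps_expansion_def by (auto elim: eventually_elim2)
qed

lemma mod_z_has_fps_expansion: "mod_z has_fps_expansion z_fps"
proof -
  have mod_z_eq: "mod_z =
      (\<lambda>q. \<Prod>j. \<Prod>k\<in>{1, 2, 3, 6}. (1 - q ^ (k * Suc j)) powi (if odd k then 4 else - 2))"
    by (rule ext) (simp add: mod_z_def power_int_minus divide_inverse mult_ac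
        del: power_Suc mult_Suc_right One_nat_def)
  show ?thesis
    unfolding mod_z_eq z_fps_def by (rule euler_quotient_has_fps_expansion) simp_all
qed

lemma mod_y_has_fps_expansion: "mod_y has_fps_expansion y_fps"
proof -
  have mod_y_eq: "mod_y =
      (\<lambda>q. q * (\<Prod>j. \<Prod>k\<in>{1, 2, 3, 6}. (1 - q ^ (k * Suc j)) powi (if odd k then - 6 else 6)))"
    by (rule ext) (simp add: mod_y_def power_int_minus divide_inverse mult_ac
        del: power_Suc mult_Suc_right One_nat_def)
  show ?thesis
    unfolding mod_y_eq y_fps_def
    by (intro has_fps_expansion_mult has_fps_expansion_fps_X euler_quotient_has_fps_expansion) simp_all
qed

lemma mod_Z_has_fps_expansion: "mod_Z has_fps_expansion Z_fps"
  unfolding mod_Z_def[abs_def] Z_fps_def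
  by (intro fps_expansion_intros mod_y_has_fps_expansion mod_z_has_fps_expansion)

lemma mod_x_has_fps_expansion: "mod_x has_fps_expansion x_fps"
  unfolding mod_x_def[abs_def] x_fps_def divide_inverse
  by (intro fps_expansion_intros mod_y_has_fps_expansion) simp

section \<open>Expansions in terms of the modular functions\<close>

lemma mod_Z_eq_eis_P: "\<forall>\<^sub>F q in nhds 0. mod_Z q = (3 * eis_P (q ^ 6) - eis_P (q ^ 2)) / 2"
proof -
  have "(\<lambda>q. 3 * eis_P (q ^ 6) - eis_P (q ^ 2)) has_fps_expansion (3 * eis_P_fps 6 - eis_P_fps 2)"
    using has_fps_expansion_compose_power[OF eis_P_has_fps_expansion, of 6]
      has_fps_expansion_compose_power[OF eis_P_has_fps_expansion, of 2]
    by (intro has_fps_expansion_diff has_fps_expansion_mult has_fps_expansion_numeral)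
       (simp_all add: eis_fps_compose_X_power del: One_nat_def)
  moreover have "(\<lambda>q. 2 * mod_Z q) has_fps_expansion (3 * eis_P_fps 6 - eis_P_fps 2)"
    unfolding Z_fps_eq_eis_P_fps[symmetric] by (intro fps_expansion_intros mod_Z_has_fps_expansion)
  ultimately have "\<forall>\<^sub>F q in nhds 0. 2 * mod_Z q = 3 * eis_P (q ^ 6) - eis_P (q ^ 2)"
    by (rule has_fps_expansion_unique_eventually[rotated])
  then show ?thesis by eventually_elim (simp add: field_simps)
qed

lemma mod_Z_sums_mod_x:
  assumes "f $ 0 = 1"
    and "sym_square_op (fps_of_poly [:1, 4, - 80, 192:]) (fps_of_poly [:0, 0, - 48, 192:]) f = 0"
  shows "\<forall>\<^sub>F q in nhds 0. (\<lambda>n. f $ n * mod_x q ^ n) sums mod_Z q"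
  using weight_2_system_eventually_sums[OF weight_2_system_x_Z assms(2) _ _ _
      mod_x_has_fps_expansion mod_Z_has_fps_expansion] assms(1) by simp

lemma mod_z_sums_domb:
  "\<forall>\<^sub>F q in nhds 0. (\<lambda>n. (- 1) ^ n * of_nat (domb n) * mod_y q ^ n) sums mod_z q"
  using weight_2_system_eventually_sums[OF weight_2_system_y_z sym_square_op_domb _ _ _
      mod_y_has_fps_expansion mod_z_has_fps_expansion] by (simp add: domb_def)

lemma mod_Z_sums_hypergeom:
  "\<forall>\<^sub>F q in nhds 0. (\<lambda>n. of_nat (((3 * n) choose n) * ((2 * n) choose n)\<^sup>2) *
     mod_x q ^ (2 * n) * (1 - 4 * mod_x q) ^ n) sums mod_Z q"
proof -
  have "(\<lambda>q. mod_x q ^ 2 * (1 - 4 * mod_x q)) has_fps_expansion (x_fps\<^sup>2 * (1 - 4 * x_fps))"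
    by (intro fps_expansion_intros mod_x_has_fps_expansion)
  from weight_2_system_eventually_sums[OF weight_2_system_cubic_x_Z sym_square_op_hypergeom _ _ _
      this mod_Z_has_fps_expansion]
  have "\<forall>\<^sub>F q in nhds 0. (\<lambda>n. hypergeom_fps $ n * (mod_x q ^ 2 * (1 - 4 * mod_x q)) ^ n) sums mod_Z q"
    by (simp add: hypergeom_fps_def)
  then show ?thesis
    by (simp only: hypergeom_fps_def fps_nth_Abs_fps power_mult_distrib power_mult mult.assoc)
qed

lemma mod_Z_sums_domb:
  "\<forall>\<^sub>F q in nhds 0.
     (\<lambda>n. (-1) ^ n * of_nat (domb n) * (mod_x q ^ n / (1 - 4 * mod_x q) ^ (n + 1))) sums mod_Z q"
proof -
  have "(\<lambda>q. (1 + 4 * mod_y q) * (1 - 4 * mod_x q)) has_fps_expansion ((1 + 4 * y_fps) * (1 - 4 * x_fps))"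
    by (intro fps_expansion_intros mod_x_has_fps_expansion mod_y_has_fps_expansion)
  then have "(\<lambda>q. (1 + 4 * mod_y q) * (1 - 4 * mod_x q)) has_fps_expansion 1"
    by (simp only: y_fps_conv_x_fps)
  from has_fps_expansion_unique_eventually[OF this has_fps_expansion_1] mod_z_sums_domb show ?thesis
  proof eventually_elim
    case (elim q)
    then have nonzero: "1 - 4 * mod_x q \<noteq> 0" "1 + 4 * mod_y q \<noteq> 0" by auto
    then have mod_y_conv_mod_x: "1 + 4 * mod_y q = 1 / (1 - 4 * mod_x q)"
      using elim(1) by (subst nonzero_eq_divide_eq)
    have "mod_y q = mod_x q * (1 + 4 * mod_y q)" using nonzero(2) by (simp add: mod_x_def)
    also have "\<dots> = mod_x q / (1 - 4 * mod_x q)" unfolding mod_y_conv_mod_x by simp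
    finally have "mod_y q ^ n = mod_x q ^ n / (1 - 4 * mod_x q) ^ n" for n
      by (simp only: power_divide)
    then have "(1 + 4 * mod_y q) * ((- 1) ^ n * of_nat (domb n) * mod_y q ^ n) =
        (-1) ^ n * of_nat (domb n) * (mod_x q ^ n / (1 - 4 * mod_x q) ^ (n + 1))" for n
      unfolding mod_y_conv_mod_x by simp
    with sums_mult[OF elim(2), of "1 + 4 * mod_y q"] show ?case
      unfolding mod_Z_def by simp
  qed
qed

theorem theorem6p4:
  fixes t :: "nat \<Rightarrow> complex"
  assumes t_0: "t 0 = 1"
    and t_rec: "\<And>n. of_nat (n + 1) ^ 3 * t (n + 1) =
        - 2 * of_nat n * of_nat (n + 1) * of_nat (2 * n + 1) * t n
        + 16 * of_nat n * (5 * of_nat n ^ 2 + 1) * t (n - 1)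
        - 96 * of_nat n * (of_nat n - 1) * (2 * of_nat n - 1) * t (n - 2)"
  shows "\<forall>\<^sub>F q in nhds (0 :: complex).
      mod_Z q = (3 * eis_P (q ^ 6) - eis_P (q ^ 2)) / 2 \<and>
      (\<lambda>n. t n * mod_x q ^ n) sums mod_Z q \<and>
      (\<lambda>n. (-1) ^ n * of_nat (domb n) * (mod_x q ^ n / (1 - 4 * mod_x q) ^ (n + 1)))
        sums mod_Z q \<and>
      (\<lambda>n. of_nat (((3 * n) choose n) * ((2 * n) choose n)\<^sup>2) *
            mod_x q ^ (2 * n) * (1 - 4 * mod_x q) ^ n) sums mod_Z q"
proof -
  have "\<forall>\<^sub>F q in nhds 0. (\<lambda>n. t n * mod_x q ^ n) sums mod_Z q"
    using mod_Z_sums_mod_x[of "Abs_fps t"] t_0 sym_square_op_t[OF t_rec] by simp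
  then show ?thesis
    using mod_Z_eq_eis_P mod_Z_sums_domb mod_Z_sums_hypergeom by (intro eventually_conj)
qed

end
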